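(* A loxodrome on a $G_X$-invariant surface $M\subset (N^3,g)$, which is not an orbit, can be locally parametrized by $\beta(u)=\psi(u,v(u))$, where $$v(u)=\int_{u_0}^u\left(\frac{-F}{\omega^2}\pm\frac{\cot\vartheta_0}{\omega}\right)dt .$$ Here $\psi(u,v)=\phi_v(\gamma(u))$ is the local parametrization of $M$, $F=g(\psi_u,\psi_v)$ and $\omega=\|X(\gamma)\|_g$ are functions of the first parameter only (evaluated at $t$ in the integral), and $\vartheta_0$ is the constant angle between the loxodrome and $X$.
   Context: $(N^3,g)$ is a three-dimensional Riemannian manifold, $X$ a Killing vector field on $N$, $G_X$ the one-parameter group of isometries generated by $X$, and $\phi_v$ the local flow of $X$. $N_r\subset N$ is the regular part (the set of points belonging to principal orbits of $G_X$). The quotient $N_r/G_X$ carries the quotient metric $\tilde g$ making $\pi:N_r\to N_r/G_X$ a Riemannian submersion. A $G_X$-invariant surface is the image in $N_r$ of an immersion $f:M\to N$ for which there is an action of $G_X$ on $M$ with $f(ax)=af(x)$ for all $a\in G_X$, $x\in M$. Locally it is parametrized by $\psi(u,v)=\phi_v(\gamma(u))$, $(u,v)\in I\times(-\epsilon,\epsilon)$, $I$ an open interval, where $\tilde\gamma:I\to (N_r/G_X,\tilde g)$ is a curve parametrized by arc length (the profile curve) and $\gamma:I\to N$ is a (not necessarily horizontal) lift of it, i.e. $d\pi(\gamma')=\tilde\gamma'$. The coefficients $E=g(\psi_u,\psi_u)$, $F=g(\psi_u,\psi_v)$, $G=g(\psi_v,\psi_v)=g(X,X)=\omega^2$ of the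 induced metric depend only on $u$; $u_0\in I$. A loxodrome on $M$ is a curve on $M$ making a constant angle $\vartheta_0\in[0,\pi)$ with $X$; if $\alpha$ is its arc-length parametrization this means $g(\alpha',X)=\omega\cos\vartheta_0$. A loxodrome that is not an orbit of $X$ has $\vartheta_0\neq 0$. *)

theory Defs
  imports "HOL-Analysis.Analysis" "HOL-Algebra.Group_Action"
begin

section \<open>Smooth maps between open subsets of Euclidean spaces\<close>

primrec C_k_on :: "nat \<Rightarrow> 'a::euclidean_space set \<Rightarrow> ('a \<Rightarrow> 'b::euclidean_space) \<Rightarrow> bool" where
  "C_k_on 0 S f \<longleftrightarrow> continuous_on S f"
| "C_k_on (Suc k) S f \<longleftrightarrow>
     (\<forall>x\<in>S. f differentiable (at x)) \<and> (\<forall>e. C_k_on k S (\<lambda>x. frechet_derivative f (at x) e))"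

definition smooth_on :: "'a::euclidean_space set \<Rightarrow> ('a \<Rightarrow> 'b::euclidean_space) \<Rightarrow> bool" where
  "smooth_on S f \<longleftrightarrow> (\<forall>k. C_k_on k S f)"


section \<open>Smooth manifolds\<close>

text \<open>A chart is a pair of a coordinate domain and a coordinate map; the dimension of a manifold is
  that of the Euclidean model space \<^typ>\<open>'e\<close>. The points are the elements of the topological space.\<close>

type_synonym ('a, 'e) chart = "'a set \<times> ('a \<Rightarrow> 'e)"

record ('a, 'e) mfd =
  mtop :: "'a topology"
  charts :: "('a, 'e) chart set"

abbreviation points :: "('a, 'e) mfd \<Rightarrow> 'a set" where
  "points N \<equiv> topspace (mtop N)"

abbreviation chart_inv :: "('a, 'e) chart \<Rightarrow> 'e \<Rightarrow> 'a" where
  "chart_inv \<kappa> \<equiv> inv_into (fst \<kappa>) (snd \<kappa>)"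

definition is_chart :: "'a topology \<Rightarrow> ('a, 'e::euclidean_space) chart \<Rightarrow> bool" where
  "is_chart T \<kappa> \<longleftrightarrow> openin T (fst \<kappa>) \<and> open (snd \<kappa> ` fst \<kappa>) \<and>
     homeomorphic_map (subtopology T (fst \<kappa>)) (top_of_set (snd \<kappa> ` fst \<kappa>)) (snd \<kappa>)"

definition smooth_manifold :: "('a, 'e::euclidean_space) mfd \<Rightarrow> bool" where
  "smooth_manifold N \<longleftrightarrow>
     Hausdorff_space (mtop N) \<and> second_countable (mtop N) \<and>
     (\<forall>\<kappa>\<in>charts N. is_chart (mtop N) \<kappa>) \<and> (\<Union>\<kappa>\<in>charts N. fst \<kappa>) = points N \<and>
     (\<forall>\<kappa>\<in>charts N. \<forall>\<kappa>'\<in>charts N.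
        smooth_on (snd \<kappa> ` (fst \<kappa> \<inter> fst \<kappa>')) (snd \<kappa>' \<circ> chart_inv \<kappa>))"

definition euclidean_mfd :: "('e, 'e::euclidean_space) mfd" where
  "euclidean_mfd = \<lparr>mtop = euclidean, charts = {(UNIV, id)}\<rparr>"

definition prod_mfd :: "('a, 'd) mfd \<Rightarrow> ('b, 'e) mfd \<Rightarrow> ('a \<times> 'b, 'd \<times> 'e) mfd" where
  "prod_mfd M N =
     \<lparr>mtop = prod_topology (mtop M) (mtop N),
      charts = {(fst \<kappa> \<times> fst \<mu>, map_prod (snd \<kappa>) (snd \<mu>)) | \<kappa> \<mu>. \<kappa> \<in> charts M \<and> \<mu> \<in> charts N}\<rparr>"

definition smooth_map_on :: "'a set \<Rightarrow> ('a, 'd::euclidean_space) mfd \<Rightarrow>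
    ('b, 'e::euclidean_space) mfd \<Rightarrow> ('a \<Rightarrow> 'b) \<Rightarrow> bool" where
  "smooth_map_on S M N f \<longleftrightarrow>
     openin (mtop M) S \<and> continuous_map (subtopology (mtop M) S) (mtop N) f \<and>
     (\<forall>\<kappa>\<in>charts M. \<forall>\<mu>\<in>charts N.
        smooth_on (snd \<kappa> ` (fst \<kappa> \<inter> S \<inter> f -` fst \<mu>)) (snd \<mu> \<circ> f \<circ> chart_inv \<kappa>))"


section \<open>Tangent vectors\<close>

text \<open>A tangent vector at \<open>p\<close> is the family of its coordinate representations, one for each chart
  around \<open>p\<close>, which transform into each other by the derivatives of the coordinate changes. The value
  at all other charts is fixed to be 0, so that equality of tangent vectors is equality of families,
  and the vector space operations are the pointwise ones.\<close>

type_synonym ('a, 'e) tvec = "('a, 'e) chart \<Rightarrow> 'e"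

definition charts_at :: "('a, 'e) mfd \<Rightarrow> 'a \<Rightarrow> ('a, 'e) chart set" where
  "charts_at N p = {\<kappa> \<in> charts N. p \<in> fst \<kappa>}"

definition tangent_space :: "('a, 'e::euclidean_space) mfd \<Rightarrow> 'a \<Rightarrow> ('a, 'e) tvec set" where
  "tangent_space N p =
     {v. (\<forall>\<kappa>\<in>charts_at N p. \<forall>\<kappa>'\<in>charts_at N p.
            v \<kappa>' = frechet_derivative (snd \<kappa>' \<circ> chart_inv \<kappa>) (at (snd \<kappa> p)) (v \<kappa>)) \<and>
         (\<forall>\<kappa>. \<kappa> \<notin> charts_at N p \<longrightarrow> v \<kappa> = 0)}"

definition coord_vec ::
    "('a, 'e::euclidean_space) mfd \<Rightarrow> ('a, 'e) chart \<Rightarrow> 'a \<Rightarrow> 'e \<Rightarrow> ('a, 'e) tvec" where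
  "coord_vec N \<kappa> p e = (\<lambda>\<kappa>'. if \<kappa>' \<in> charts_at N p
     then frechet_derivative (snd \<kappa>' \<circ> chart_inv \<kappa>) (at (snd \<kappa> p)) e else 0)"

definition velocity ::
    "('a, 'e::euclidean_space) mfd \<Rightarrow> (real \<Rightarrow> 'a) \<Rightarrow> real \<Rightarrow> ('a, 'e) tvec" where
  "velocity N c t = (\<lambda>\<kappa>. if \<kappa> \<in> charts_at N (c t)
     then vector_derivative (snd \<kappa> \<circ> c) (at t) else 0)"

text \<open>For differentiable \<open>f\<close> the choice of the chart \<open>\<kappa>\<close> around \<open>p\<close> is immaterial.\<close>

definition differential :: "('a, 'd::euclidean_space) mfd \<Rightarrow> ('b, 'e::euclidean_space) mfd \<Rightarrow>
    ('a \<Rightarrow> 'b) \<Rightarrow> 'a \<Rightarrow> ('a, 'd) tvec \<Rightarrow> ('b, 'e) tvec" where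
  "differential M N f p v = (let \<kappa> = (SOME \<kappa>. \<kappa> \<in> charts_at M p) in
     (\<lambda>\<mu>. if \<mu> \<in> charts_at N (f p)
        then frechet_derivative (snd \<mu> \<circ> f \<circ> chart_inv \<kappa>) (at (snd \<kappa> p)) (v \<kappa>) else 0))"


section \<open>Riemannian metrics and Riemannian submersions\<close>

type_synonym ('a, 'e) metric_field = "'a \<Rightarrow> ('a, 'e) tvec \<Rightarrow> ('a, 'e) tvec \<Rightarrow> real"

definition riemannian_manifold ::
    "('a, 'e::euclidean_space) mfd \<Rightarrow> ('a, 'e) metric_field \<Rightarrow> bool" where
  "riemannian_manifold N g \<longleftrightarrow> smooth_manifold N \<and>
     (\<forall>p\<in>points N.
        (\<forall>v\<in>tangent_space N p. \<forall>w\<in>tangent_space N p. g p v w = g p w v) \<and>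
        (\<forall>v\<in>tangent_space N p. \<forall>w\<in>tangent_space N p. \<forall>z\<in>tangent_space N p. \<forall>a b.
           g p (\<lambda>\<kappa>. a *\<^sub>R v \<kappa> + b *\<^sub>R w \<kappa>) z = a * g p v z + b * g p w z) \<and>
        (\<forall>v\<in>tangent_space N p. v \<noteq> (\<lambda>_. 0) \<longrightarrow> 0 < g p v v)) \<and>
     (\<forall>\<kappa>\<in>charts N. \<forall>d e. smooth_on (snd \<kappa> ` fst \<kappa>) (\<lambda>y.
        g (chart_inv \<kappa> y) (coord_vec N \<kappa> (chart_inv \<kappa> y) d) (coord_vec N \<kappa> (chart_inv \<kappa> y) e)))"

definition vec_norm :: "('a, 'e) metric_field \<Rightarrow> 'a \<Rightarrow> ('a, 'e) tvec \<Rightarrow> real" where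
  "vec_norm g p v = sqrt (g p v v)"

definition horizontal_space :: "('a, 'd::euclidean_space) mfd \<Rightarrow> ('a, 'd) metric_field \<Rightarrow>
    ('b, 'e::euclidean_space) mfd \<Rightarrow> ('a \<Rightarrow> 'b) \<Rightarrow> 'a \<Rightarrow> ('a, 'd) tvec set" where
  "horizontal_space N g B \<pi> p = {v \<in> tangent_space N p.
     \<forall>w\<in>tangent_space N p. differential N B \<pi> p w = (\<lambda>_. 0) \<longrightarrow> g p v w = 0}"

definition riemannian_submersion_on :: "'a set \<Rightarrow> ('a, 'd::euclidean_space) mfd \<Rightarrow>
    ('a, 'd) metric_field \<Rightarrow> ('b, 'e::euclidean_space) mfd \<Rightarrow> ('b, 'e) metric_field \<Rightarrow>
    ('a \<Rightarrow> 'b) \<Rightarrow> bool" where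
  "riemannian_submersion_on S N g B gB \<pi> \<longleftrightarrow> smooth_map_on S N B \<pi> \<and>
     (\<forall>p\<in>S. differential N B \<pi> p ` tangent_space N p = tangent_space B (\<pi> p) \<and>
        (\<forall>v\<in>horizontal_space N g B \<pi> p. \<forall>w\<in>horizontal_space N g B \<pi> p.
           gB (\<pi> p) (differential N B \<pi> p v) (differential N B \<pi> p w) = g p v w))"


section \<open>Killing fields and their one-parameter groups\<close>

definition smooth_vector_field ::
    "('a, 'e::euclidean_space) mfd \<Rightarrow> ('a \<Rightarrow> ('a, 'e) tvec) \<Rightarrow> bool" where
  "smooth_vector_field N X \<longleftrightarrow> (\<forall>p\<in>points N. X p \<in> tangent_space N p) \<and>
     (\<forall>\<kappa>\<in>charts N. smooth_on (snd \<kappa> ` fst \<kappa>) (\<lambda>y. X (chart_inv \<kappa> y) \<kappa>))"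

text \<open>A vector field is Killing if its flow acts by isometries. As the flow generates a group acting
  on all of \<open>N\<close>, it is defined for all times. The maps \<open>\<phi> t\<close> are extensional, so that they are
  elements of \<^term>\<open>BijGroup (points N)\<close>.\<close>

definition killing_field_flow :: "('a, 'e::euclidean_space) mfd \<Rightarrow> ('a, 'e) metric_field \<Rightarrow>
    ('a \<Rightarrow> ('a, 'e) tvec) \<Rightarrow> (real \<Rightarrow> 'a \<Rightarrow> 'a) \<Rightarrow> bool" where
  "killing_field_flow N g X \<phi> \<longleftrightarrow> smooth_vector_field N X \<and>
     (\<forall>t. \<phi> t \<in> Bij (points N)) \<and> \<phi> 0 = (\<lambda>p\<in>points N. p) \<and>
     (\<forall>s t. \<phi> (s + t) = compose (points N) (\<phi> s) (\<phi> t)) \<and>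
     smooth_map_on (UNIV \<times> points N) (prod_mfd euclidean_mfd N) N (\<lambda>(t, p). \<phi> t p) \<and>
     (\<forall>p\<in>points N. \<forall>t. velocity N (\<lambda>s. \<phi> s p) t = X (\<phi> t p)) \<and>
     (\<forall>t. \<forall>p\<in>points N. \<forall>v\<in>tangent_space N p. \<forall>w\<in>tangent_space N p.
        g (\<phi> t p) (differential N N (\<phi> t) p v) (differential N N (\<phi> t) p w) = g p v w)"

definition flow_group :: "('a, 'e) mfd \<Rightarrow> (real \<Rightarrow> 'a \<Rightarrow> 'a) \<Rightarrow> ('a \<Rightarrow> 'a) monoid" where
  "flow_group N \<phi> = (BijGroup (points N))\<lparr>carrier := range \<phi>\<rparr>"

abbreviation flow_orbit :: "('a, 'e) mfd \<Rightarrow> (real \<Rightarrow> 'a \<Rightarrow> 'a) \<Rightarrow> 'a \<Rightarrow> 'a set" where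
  "flow_orbit N \<phi> p \<equiv> orbit (flow_group N \<phi>) (\<lambda>a. a) p"

abbreviation flow_stabilizer :: "('a, 'e) mfd \<Rightarrow> (real \<Rightarrow> 'a \<Rightarrow> 'a) \<Rightarrow> 'a \<Rightarrow> ('a \<Rightarrow> 'a) set" where
  "flow_stabilizer N \<phi> p \<equiv> stabilizer (flow_group N \<phi>) (\<lambda>a. a) p"

text \<open>An orbit is principal if its isotropy groups are, up to conjugation, contained in all isotropy
  groups; the conjugates of the isotropy group of \<open>q\<close> are those of the other points of its orbit.\<close>

definition regular_part :: "('a, 'e) mfd \<Rightarrow> (real \<Rightarrow> 'a \<Rightarrow> 'a) \<Rightarrow> 'a set" where
  "regular_part N \<phi> = {p \<in> points N. \<forall>q\<in>points N. \<exists>q'\<in>flow_orbit N \<phi> q.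
     flow_stabilizer N \<phi> p \<subseteq> flow_stabilizer N \<phi> q'}"

definition riemannian_quotient :: "('a, 'd::euclidean_space) mfd \<Rightarrow> ('a, 'd) metric_field \<Rightarrow>
    (real \<Rightarrow> 'a \<Rightarrow> 'a) \<Rightarrow> ('a set, 'e::euclidean_space) mfd \<Rightarrow> ('a set, 'e) metric_field \<Rightarrow> bool"
  where
  "riemannian_quotient N g \<phi> B gB \<longleftrightarrow> riemannian_manifold B gB \<and>
     quotient_map (subtopology (mtop N) (regular_part N \<phi>)) (mtop B) (flow_orbit N \<phi>) \<and>
     riemannian_submersion_on (regular_part N \<phi>) N g B gB (flow_orbit N \<phi>)"


section \<open>Invariant surfaces, their local parametrizations, and loxodromes\<close>

text \<open>The surface is \<open>f ` points M\<close>, and \<open>\<rho>\<close> is a smooth action on \<open>M\<close> making \<open>f\<close> equivariant.\<close>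

definition invariant_surface :: "('a, 'd::euclidean_space) mfd \<Rightarrow> (real \<Rightarrow> 'a \<Rightarrow> 'a) \<Rightarrow>
    ('m, real^2) mfd \<Rightarrow> ('m \<Rightarrow> 'a) \<Rightarrow> (('a \<Rightarrow> 'a) \<Rightarrow> 'm \<Rightarrow> 'm) \<Rightarrow> bool" where
  "invariant_surface N \<phi> M f \<rho> \<longleftrightarrow> smooth_manifold M \<and>
     smooth_map_on (points M) M N f \<and>
     (\<forall>x\<in>points M. inj_on (differential M N f x) (tangent_space M x)) \<and>
     f ` points M \<subseteq> regular_part N \<phi> \<and>
     group_action (flow_group N \<phi>) (points M) \<rho> \<and>
     smooth_map_on (UNIV \<times> points M) (prod_mfd euclidean_mfd M) M (\<lambda>(t, x). \<rho> (\<phi> t) x) \<and>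
     (\<forall>a\<in>carrier (flow_group N \<phi>). \<forall>x\<in>points M. f (\<rho> a x) = a (f x))"

definition profile_curve :: "('b, 'e::euclidean_space) mfd \<Rightarrow> ('b, 'e) metric_field \<Rightarrow>
    real set \<Rightarrow> (real \<Rightarrow> 'b) \<Rightarrow> bool" where
  "profile_curve B gB I c \<longleftrightarrow> smooth_map_on I euclidean_mfd B c \<and>
     (\<forall>u\<in>I. vec_norm gB (c u) (velocity B c u) = 1)"

definition lift_of_curve :: "'a set \<Rightarrow> ('a, 'd::euclidean_space) mfd \<Rightarrow>
    ('b, 'e::euclidean_space) mfd \<Rightarrow> ('a \<Rightarrow> 'b) \<Rightarrow> real set \<Rightarrow> (real \<Rightarrow> 'b) \<Rightarrow> (real \<Rightarrow> 'a) \<Rightarrow> bool"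
  where
  "lift_of_curve S N B \<pi> I c \<gamma> \<longleftrightarrow> smooth_map_on I euclidean_mfd N \<gamma> \<and> \<gamma> ` I \<subseteq> S \<and>
     (\<forall>u\<in>I. \<pi> (\<gamma> u) = c u \<and> differential N B \<pi> (\<gamma> u) (velocity N \<gamma> u) = velocity B c u)"

definition regular_parametrization ::
    "('m, real^2) mfd \<Rightarrow> (real \<times> real) set \<Rightarrow> (real \<times> real \<Rightarrow> 'm) \<Rightarrow> bool" where
  "regular_parametrization M W \<Psi> \<longleftrightarrow>
     smooth_map_on W (prod_mfd euclidean_mfd euclidean_mfd) M \<Psi> \<and> openin (mtop M) (\<Psi> ` W) \<and>
     homeomorphic_map (top_of_set W) (subtopology (mtop M) (\<Psi> ` W)) \<Psi> \<and>
     (\<forall>w\<in>W. inj_on (differential (prod_mfd euclidean_mfd euclidean_mfd) M \<Psi> w)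
              (tangent_space (prod_mfd euclidean_mfd euclidean_mfd) w))"

definition flow_param :: "(real \<Rightarrow> 'a \<Rightarrow> 'a) \<Rightarrow> (real \<Rightarrow> 'a) \<Rightarrow> real \<Rightarrow> real \<Rightarrow> 'a" where
  "flow_param \<phi> \<gamma> u v = \<phi> v (\<gamma> u)"

text \<open>As \<open>f\<close> need not be injective, the parametrization is the composition of \<open>f\<close> with a regular
  parametrization \<open>\<Psi>\<close> of an open subset of \<open>M\<close>.\<close>

definition invariant_parametrization :: "('a, 'd::euclidean_space) mfd \<Rightarrow>
    (real \<Rightarrow> 'a \<Rightarrow> 'a) \<Rightarrow> ('a set, 'e::euclidean_space) mfd \<Rightarrow> ('a set, 'e) metric_field \<Rightarrow>
    ('m, real^2) mfd \<Rightarrow> ('m \<Rightarrow> 'a) \<Rightarrow> real set \<Rightarrow> real \<Rightarrow> (real \<Rightarrow> 'a set) \<Rightarrow> (real \<Rightarrow> 'a) \<Rightarrow>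
    (real \<times> real \<Rightarrow> 'm) \<Rightarrow> bool" where
  "invariant_parametrization N \<phi> B gB M f I \<epsilon> c \<gamma> \<Psi> \<longleftrightarrow>
     open I \<and> is_interval I \<and> 0 < \<epsilon> \<and>
     profile_curve B gB I c \<and>
     lift_of_curve (regular_part N \<phi>) N B (flow_orbit N \<phi>) I c \<gamma> \<and>
     regular_parametrization M (I \<times> {-\<epsilon><..<\<epsilon>}) \<Psi> \<and>
     (\<forall>u\<in>I. \<forall>v\<in>{-\<epsilon><..<\<epsilon>}. f (\<Psi> (u, v)) = flow_param \<phi> \<gamma> u v)"

definition coeff_F :: "('a, 'e::euclidean_space) mfd \<Rightarrow> ('a, 'e) metric_field \<Rightarrow>
    (real \<Rightarrow> real \<Rightarrow> 'a) \<Rightarrow> real \<Rightarrow> real \<Rightarrow> real" where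
  "coeff_F N g \<psi> u v =
     g (\<psi> u v) (velocity N (\<lambda>r. \<psi> r v) u) (velocity N (\<lambda>r. \<psi> u r) v)"

text \<open>A loxodrome is given by its arc-length parametrization \<open>f \<circ> c\<close>, where \<open>c\<close> is a curve in \<open>M\<close>.\<close>

definition loxodrome :: "('a, 'e::euclidean_space) mfd \<Rightarrow> ('a, 'e) metric_field \<Rightarrow>
    ('a \<Rightarrow> ('a, 'e) tvec) \<Rightarrow> ('m, real^2) mfd \<Rightarrow> ('m \<Rightarrow> 'a) \<Rightarrow> real set \<Rightarrow> (real \<Rightarrow> 'm) \<Rightarrow> real \<Rightarrow>
    bool" where
  "loxodrome N g X M f J c \<theta> \<longleftrightarrow> open J \<and> is_interval J \<and> smooth_map_on J euclidean_mfd M c \<and>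
     0 \<le> \<theta> \<and> \<theta> < pi \<and>
     (\<forall>s\<in>J. vec_norm g (f (c s)) (velocity N (f \<circ> c) s) = 1 \<and>
        g (f (c s)) (velocity N (f \<circ> c) s) (X (f (c s))) = vec_norm g (f (c s)) (X (f (c s))) * cos \<theta>)"

definition reparametrization :: "real set \<Rightarrow> real set \<Rightarrow> (real \<Rightarrow> real) \<Rightarrow> bool" where
  "reparametrization J I h \<longleftrightarrow> open J \<and> is_interval J \<and> open I \<and> is_interval I \<and>
     bij_betw h J I \<and> smooth_on J h \<and> (\<forall>s\<in>J. deriv h s \<noteq> 0)"

end

theory Submission
  imports Defs
begin

text \<open>Write the loxodrome locally as \<open>\<phi> (k s) (\<gamma> (h s))\<close>. The flow is by isometries preserving \<open>X\<close>,
  so unit speed and constant angle are equations for \<open>h'\<close> and \<open>k'\<close> whose coefficients \<open>E\<close>, \<open>F\<close>, \<open>\<omega>\<^sup>2\<close>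
  are evaluated along \<open>\<gamma>\<close>. Because \<open>\<pi>\<close> is a Riemannian submersion with fibres tangent to \<open>X\<close> and the
  profile curve has unit speed, \<open>E - F\<^sup>2 / \<omega>\<^sup>2 = 1\<close>. The equations become \<open>h'\<^sup>2 = sin\<^sup>2 \<theta>\<^sub>0\<close> and
  \<open>k' = (\<omega> cos \<theta>\<^sub>0 - h' F) / \<omega>\<^sup>2\<close>; hence \<open>h\<close> is affine and \<open>dk/du\<close> is the integrand of \<open>v\<close>. If
  \<open>\<theta>\<^sub>0 = 0\<close>, the velocity is a multiple of \<open>X\<close>, which \<open>d\<pi>\<close> annihilates, so that the loxodrome stays
  in a fibre of \<open>\<pi>\<close>.\<close>

section \<open>Charts\<close>

text \<open>As \<open>f\<close> need not be injective, a point of \<open>N\<close> does not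
  determine the coordinates \<open>h\<close> and \<open>k\<close>. They are read off in
  \<open>M\<close>, where \<open>\<Psi>\<close> is a homeomorphism with injective differential; this
  is also what makes them differentiable. The equation for \<open>h'\<close> is quadratic and leaves
  a sign. Near \<open>s\<^sub>0\<close> the sign is constant, because \<open>h'\<close> never
  vanishes there, and it is the same sign that stands in front of
  \<open>cot \<theta>\<^sub>0\<close>. Excluding the angle 0 is a statement about all of
  \<open>J\<close>, also where the loxodrome has left the patch, and it needs \<open>X\<close> to be
  nonzero there. On the patch \<open>X\<close> is the image of a coordinate vector under an
  immersion. Elsewhere the reason is different: a zero of \<open>X\<close> in the regular part would
  make the whole flow trivial. Finally, the kernel of the differential of \<pi> is spanned by
  \<open>X\<close> only because the dimension drops by exactly one, from 3 to 2.\<close>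

text \<open>Smoothness of coordinate changes is dropped on purpose: the chain rule does not need it,
  as \<open>diff_at\<close> below speaks about all pairs of charts, and the remaining conditions
  pass to products with little effort.\<close>

definition charted :: "('a, 'e::euclidean_space) mfd \<Rightarrow> bool" where
  "charted N \<longleftrightarrow> (\<forall>\<kappa>\<in>charts N. is_chart (mtop N) \<kappa>) \<and> (\<Union>\<kappa>\<in>charts N. fst \<kappa>) = points N"

lemma smooth_manifold_imp_charted: "smooth_manifold N \<Longrightarrow> charted N"
  unfolding smooth_manifold_def charted_def by blast

lemma charts_at_nonempty:
  assumes "charted N" "p \<in> points N"
  obtains \<kappa> where "\<kappa> \<in> charts_at N p"
  using assms unfolding charted_def charts_at_def by blast

lemma some_chart_at:
  assumes "charted N" "p \<in> points N"
  shows "(SOME \<kappa>. \<kappa> \<in> charts_at N p) \<in> charts_at N p"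
  by (meson assms charts_at_nonempty someI_ex)

lemma charts_atD:
  assumes "charted N" "\<kappa> \<in> charts_at N p"
  shows "is_chart (mtop N) \<kappa>" "\<kappa> \<in> charts N" "p \<in> fst \<kappa>"
  using assms unfolding charted_def charts_at_def by auto

lemma is_chart_subset: "is_chart T \<kappa> \<Longrightarrow> fst \<kappa> \<subseteq> topspace T"
  by (simp add: is_chart_def openin_subset)

lemma is_chart_inj_on:
  assumes "is_chart T \<kappa>" shows "inj_on (snd \<kappa>) (fst \<kappa>)"
proof -
  have "topspace (subtopology T (fst \<kappa>)) = fst \<kappa>"
    using is_chart_subset[OF assms] by auto
  then show ?thesis
    using assms unfolding is_chart_def
    by (metis homeomorphic_imp_injective_map)
qed

lemma chart_inv_left: "is_chart T \<kappa> \<Longrightarrow> q \<in> fst \<kappa> \<Longrightarrow> chart_inv \<kappa> (snd \<kappa> q) = q"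
  by (simp add: is_chart_inj_on)

lemma is_chart_open_image:
  assumes \<kappa>: "is_chart T \<kappa>" and U: "openin T U"
  shows "open (snd \<kappa> ` (fst \<kappa> \<inter> U))"
proof -
  have "openin (subtopology T (fst \<kappa>)) (fst \<kappa> \<inter> U)"
    using U by (auto simp: openin_subtopology)
  moreover have "open_map (subtopology T (fst \<kappa>)) (top_of_set (snd \<kappa> ` fst \<kappa>)) (snd \<kappa>)"
    using \<kappa> unfolding is_chart_def by (simp add: homeomorphic_imp_open_map)
  ultimately have "openin (top_of_set (snd \<kappa> ` fst \<kappa>)) (snd \<kappa> ` (fst \<kappa> \<inter> U))"
    unfolding open_map_def by blast
  then show ?thesis
    using \<kappa> unfolding is_chart_def by (meson openin_open_trans)
qed

text \<open>Outside the image of the chart domain \<open>chart_inv\<close> is an arbitrary function,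
  so coordinate formulas can hold only near the point. Derivatives see nothing else.\<close>

lemma eventually_chart_inv:
  assumes \<kappa>: "is_chart T \<kappa>" and "p \<in> fst \<kappa>" "openin T U" "p \<in> U"
  shows "\<forall>\<^sub>F y in nhds (snd \<kappa> p).
    chart_inv \<kappa> y \<in> fst \<kappa> \<and> chart_inv \<kappa> y \<in> U \<and> snd \<kappa> (chart_inv \<kappa> y) = y"
  unfolding eventually_nhds
proof (intro exI conjI ballI)
  show "open (snd \<kappa> ` (fst \<kappa> \<inter> U))"
    by (rule is_chart_open_image) fact+
  show "snd \<kappa> p \<in> snd \<kappa> ` (fst \<kappa> \<inter> U)"
    using assms by blast
qed (auto simp: chart_inv_left[OF \<kappa>])

lemma is_chart_prod:
  assumes \<kappa>: "is_chart S \<kappa>" and \<mu>: "is_chart T \<mu>"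
  shows "is_chart (prod_topology S T) (fst \<kappa> \<times> fst \<mu>, map_prod (snd \<kappa>) (snd \<mu>))"
proof -
  obtain k m where k: "homeomorphic_maps (subtopology S (fst \<kappa>)) (top_of_set (snd \<kappa> ` fst \<kappa>)) (snd \<kappa>) k"
    and m: "homeomorphic_maps (subtopology T (fst \<mu>)) (top_of_set (snd \<mu> ` fst \<mu>)) (snd \<mu>) m"
    using \<kappa> \<mu> unfolding is_chart_def homeomorphic_map_maps by blast
  then have "homeomorphic_maps
      (prod_topology (subtopology S (fst \<kappa>)) (subtopology T (fst \<mu>)))
      (prod_topology (top_of_set (snd \<kappa> ` fst \<kappa>)) (top_of_set (snd \<mu> ` fst \<mu>)))
      (\<lambda>(x, y). (snd \<kappa> x, snd \<mu> y)) (\<lambda>(x, y). (k x, m y))"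
    unfolding homeomorphic_maps_prod by blast
  then have "homeomorphic_map (subtopology (prod_topology S T) (fst \<kappa> \<times> fst \<mu>))
      (top_of_set (snd \<kappa> ` fst \<kappa> \<times> snd \<mu> ` fst \<mu>)) (map_prod (snd \<kappa>) (snd \<mu>))"
    unfolding homeomorphic_map_maps map_prod_def by (auto simp: subtopology_Times)
  moreover have "map_prod (snd \<kappa>) (snd \<mu>) ` (fst \<kappa> \<times> fst \<mu>) = snd \<kappa> ` fst \<kappa> \<times> snd \<mu> ` fst \<mu>"
    by auto
  ultimately show ?thesis
    using \<kappa> \<mu> unfolding is_chart_def by (simp add: openin_prod_Times_iff open_Times)
qed

section \<open>Euclidean spaces and products\<close>

lemma charted_euclidean: "charted (euclidean_mfd :: ('e::euclidean_space, 'e) mfd)"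
  by (simp add: charted_def euclidean_mfd_def is_chart_def)

lemma charted_prod:
  assumes "charted M" "charted N" shows "charted (prod_mfd M N)"
proof -
  have chart: "is_chart (mtop (prod_mfd M N)) \<kappa>" if \<kappa>: "\<kappa> \<in> charts (prod_mfd M N)" for \<kappa>
  proof -
    obtain \<mu> \<nu> where "\<mu> \<in> charts M" "\<nu> \<in> charts N"
      and eq: "\<kappa> = (fst \<mu> \<times> fst \<nu>, map_prod (snd \<mu>) (snd \<nu>))"
      using \<kappa> unfolding prod_mfd_def mfd.simps mem_Collect_eq by blast
    then have "is_chart (mtop M) \<mu>" "is_chart (mtop N) \<nu>"
      using assms unfolding charted_def by blast+
    then show ?thesis
      unfolding eq prod_mfd_def mfd.simps by (rule is_chart_prod)
  qed
  have cover: "x \<in> (\<Union>\<kappa>\<in>charts (prod_mfd M N). fst \<kappa>)" if x: "x \<in> points (prod_mfd M N)" for x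
  proof -
    have "fst x \<in> points M" "snd x \<in> points N"
      using x by (auto simp: prod_mfd_def)
    then obtain \<mu> \<nu> where "\<mu> \<in> charts M" "fst x \<in> fst \<mu>" "\<nu> \<in> charts N" "snd x \<in> fst \<nu>"
      using assms unfolding charted_def by blast
    then have "(fst \<mu> \<times> fst \<nu>, map_prod (snd \<mu>) (snd \<nu>)) \<in> charts (prod_mfd M N)"
      "x \<in> fst (fst \<mu> \<times> fst \<nu>, map_prod (snd \<mu>) (snd \<nu>))"
      unfolding prod_mfd_def mfd.simps mem_Collect_eq fst_conv mem_Times_iff by blast+
    then show ?thesis
      by (rule UN_I)
  qed
  show ?thesis
    unfolding charted_def
  proof (intro conjI ballI chart equalityI subsetI cover)
    fix x assume "x \<in> (\<Union>\<kappa>\<in>charts (prod_mfd M N). fst \<kappa>)"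
    then obtain \<kappa> where "\<kappa> \<in> charts (prod_mfd M N)" "x \<in> fst \<kappa>"
      by (rule UN_E)
    then show "x \<in> points (prod_mfd M N)"
      using is_chart_subset[OF chart] by (rule_tac subsetD)
  qed
qed

text \<open>Maps on the parameter plane can thus be treated as maps on a single Euclidean space with
  one identity chart.\<close>

lemma prod_mfd_euclidean:
  "prod_mfd euclidean_mfd euclidean_mfd =
     (euclidean_mfd :: ('d::euclidean_space \<times> 'e::euclidean_space, 'd \<times> 'e) mfd)"
  by (simp add: prod_mfd_def euclidean_mfd_def map_prod.id)

lemma points_euclidean [simp]: "points euclidean_mfd = UNIV"
  by (simp add: euclidean_mfd_def)

lemma openin_euclidean_mfd [simp]: "openin (mtop euclidean_mfd) U \<longleftrightarrow> open U"
  by (simp add: euclidean_mfd_def)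

lemma charts_at_euclidean [simp]: "charts_at euclidean_mfd x = {(UNIV, id)}"
  by (auto simp: charts_at_def euclidean_mfd_def)


section \<open>Differentiable maps\<close>

text \<open>The neighbourhood clause cannot be derived from the last one: where \<open>f\<close>
  leaves the domain of \<open>\<mu>\<close>, the coordinate representation has arbitrary values and
  says nothing about continuity.\<close>

definition diff_at :: "('a, 'd::euclidean_space) mfd \<Rightarrow> ('b, 'e::euclidean_space) mfd \<Rightarrow>
    ('a \<Rightarrow> 'b) \<Rightarrow> 'a \<Rightarrow> bool" where
  "diff_at M N f p \<longleftrightarrow> p \<in> points M \<and> f p \<in> points N \<and>
     (\<forall>U. openin (mtop N) U \<and> f p \<in> U \<longrightarrow> (\<exists>V. openin (mtop M) V \<and> p \<in> V \<and> f ` V \<subseteq> U)) \<and>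
     (\<forall>\<kappa>\<in>charts_at M p. \<forall>\<mu>\<in>charts_at N (f p).
        (snd \<mu> \<circ> f \<circ> chart_inv \<kappa>) differentiable (at (snd \<kappa> p)))"

lemma diff_at_points: "diff_at M N f p \<Longrightarrow> p \<in> points M" "diff_at M N f p \<Longrightarrow> f p \<in> points N"
  by (simp_all add: diff_at_def)

lemma diff_atD_top:
  assumes "diff_at M N f p" "openin (mtop N) U" "f p \<in> U"
  obtains V where "openin (mtop M) V" "p \<in> V" "f ` V \<subseteq> U"
  using assms unfolding diff_at_def by blast

lemma diff_atD_deriv:
  assumes "diff_at M N f p" "\<kappa> \<in> charts_at M p" "\<mu> \<in> charts_at N (f p)"
  shows "(snd \<mu> \<circ> f \<circ> chart_inv \<kappa> has_derivative
    frechet_derivative (snd \<mu> \<circ> f \<circ> chart_inv \<kappa>) (at (snd \<kappa> p))) (at (snd \<kappa> p))"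
  using assms unfolding diff_at_def by (metis frechet_derivative_works)

lemma smooth_on_differentiable:
  assumes "smooth_on S f" "x \<in> S" shows "f differentiable (at x)"
proof -
  have "C_k_on (Suc 0) S f"
    using assms(1) by (simp only: smooth_on_def)
  then show ?thesis
    using assms(2) by simp
qed

lemma smooth_on_continuous_on:
  assumes "smooth_on S f" shows "continuous_on S f"
proof -
  have "C_k_on 0 S f"
    using assms by (simp only: smooth_on_def)
  then show ?thesis
    by simp
qed

lemma smooth_on_continuous_derivative:
  assumes "smooth_on S f" shows "continuous_on S (\<lambda>x. frechet_derivative f (at x) e)"
proof -
  have "C_k_on (Suc 0) S f"
    using assms by (simp only: smooth_on_def)
  then show ?thesis
    by simp
qed

lemma smooth_map_on_vimage:
  assumes f: "smooth_map_on S M N f" and U: "openin (mtop N) U"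
  shows "openin (mtop M) {x \<in> S. f x \<in> U}"
proof -
  have S: "openin (mtop M) S" and c: "continuous_map (subtopology (mtop M) S) (mtop N) f"
    using f unfolding smooth_map_on_def by auto
  have "topspace (subtopology (mtop M) S) = S"
    using openin_subset[OF S] by auto
  then have "openin (subtopology (mtop M) S) {x \<in> S. f x \<in> U}"
    using c U unfolding continuous_map_def by auto
  then show ?thesis
    using S openin_trans_full by blast
qed

lemma smooth_map_on_diff_at:
  assumes f: "smooth_map_on S M N f" and p: "p \<in> S"
  shows "diff_at M N f p"
  unfolding diff_at_def
proof (intro conjI allI impI ballI)
  have S: "openin (mtop M) S" and c: "continuous_map (subtopology (mtop M) S) (mtop N) f"
    using f unfolding smooth_map_on_def by auto
  show pM: "p \<in> points M"
    using p openin_subset[OF S] by auto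
  then show "f p \<in> points N"
    using p continuous_map_image_subset_topspace[OF c] by auto
next
  fix U assume "openin (mtop N) U \<and> f p \<in> U"
  then show "\<exists>V. openin (mtop M) V \<and> p \<in> V \<and> f ` V \<subseteq> U"
    using smooth_map_on_vimage[OF f, of U] p by (intro exI[of _ "{x \<in> S. f x \<in> U}"]) auto
next
  fix \<kappa> \<mu> assume "\<kappa> \<in> charts_at M p" "\<mu> \<in> charts_at N (f p)"
  then have "\<kappa> \<in> charts M" "\<mu> \<in> charts N" "snd \<kappa> p \<in> snd \<kappa> ` (fst \<kappa> \<inter> S \<inter> f -` fst \<mu>)"
    using p unfolding charts_at_def by auto
  then show "(snd \<mu> \<circ> f \<circ> chart_inv \<kappa>) differentiable (at (snd \<kappa> p))"
    using f smooth_on_differentiable unfolding smooth_map_on_def by blast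
qed

text \<open>The chain rule with the last map \<open>k\<close> going straight into a vector space.
  Its instances are the composition of maps between manifolds (\<open>k\<close> a chart after a
  map), changes of coordinates (\<open>k\<close> a chart), and the inverse of a
  parametrization.\<close>

lemma chart_rep_compose:
  assumes M: "charted M" and N: "charted N" and f: "diff_at M N f p"
    and \<kappa>: "\<kappa> \<in> charts_at M p" and \<mu>: "\<mu> \<in> charts_at N (f p)"
    and D: "(snd \<mu> \<circ> f \<circ> chart_inv \<kappa> has_derivative D) (at (snd \<kappa> p))"
    and D': "(k \<circ> chart_inv \<mu> has_derivative D') (at (snd \<mu> (f p)))"
  shows "(k \<circ> f \<circ> chart_inv \<kappa> has_derivative D' \<circ> D) (at (snd \<kappa> p))"
proof -
  note k = charts_atD[OF M \<kappa>] and m = charts_atD[OF N \<mu>]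
  obtain V where V: "openin (mtop M) V" "p \<in> V" "f ` V \<subseteq> fst \<mu>"
    using diff_atD_top[OF f, of "fst \<mu>"] m unfolding is_chart_def by blast
  have "((k \<circ> chart_inv \<mu>) \<circ> (snd \<mu> \<circ> f \<circ> chart_inv \<kappa>) has_derivative D' \<circ> D) (at (snd \<kappa> p))"
    using D D' by (intro diff_chain_at) (simp_all add: chart_inv_left[OF k(1) k(3)])
  \<comment> \<open>Continuity keeps \<open>f\<close> inside the domain of \<open>\<mu>\<close> near
    \<open>p\<close>, so the inserted pair of \<open>chart_inv \<mu>\<close> and
    \<open>snd \<mu>\<close> cancels there.\<close>
  moreover have eq: "\<forall>\<^sub>F y in nhds (snd \<kappa> p).
      ((k \<circ> chart_inv \<mu>) \<circ> (snd \<mu> \<circ> f \<circ> chart_inv \<kappa>)) y = (k \<circ> f \<circ> chart_inv \<kappa>) y"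
    using eventually_chart_inv[OF k(1) k(3) V(1) V(2)]
    by eventually_elim (use V(3) chart_inv_left[OF m(1)] in auto)
  then have "\<forall>\<^sub>F y in at (snd \<kappa> p).
      ((k \<circ> chart_inv \<mu>) \<circ> (snd \<mu> \<circ> f \<circ> chart_inv \<kappa>)) y = (k \<circ> f \<circ> chart_inv \<kappa>) y"
    unfolding eventually_at_filter by (rule eventually_mono) simp
  ultimately show ?thesis
    using eventually_nhds_x_imp_x[OF eq] by (rule has_derivative_transform_eventually) simp
qed

lemma diff_at_compose:
  assumes M: "charted M" and N: "charted N" and f: "diff_at M N f p" and g: "diff_at N P g (f p)"
  shows "diff_at M P (g \<circ> f) p"
  unfolding diff_at_def
proof (intro conjI allI impI ballI)
  show "p \<in> points M" "(g \<circ> f) p \<in> points P"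
    using f g by (auto simp: diff_at_def)
next
  fix U assume "openin (mtop P) U \<and> (g \<circ> f) p \<in> U"
  then obtain V where "openin (mtop N) V" "f p \<in> V" "g ` V \<subseteq> U"
    using diff_atD_top[OF g] by (metis comp_apply)
  moreover then obtain W where "openin (mtop M) W" "p \<in> W" "f ` W \<subseteq> V"
    using diff_atD_top[OF f] by metis
  ultimately show "\<exists>V. openin (mtop M) V \<and> p \<in> V \<and> (g \<circ> f) ` V \<subseteq> U"
    by (intro exI[of _ W]) auto
next
  fix \<kappa> \<nu> assume \<kappa>: "\<kappa> \<in> charts_at M p" and \<nu>: "\<nu> \<in> charts_at P ((g \<circ> f) p)"
  obtain \<mu> where \<mu>: "\<mu> \<in> charts_at N (f p)"
    using charts_at_nonempty[OF N diff_at_points(2)[OF f]] .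
  show "(snd \<nu> \<circ> (g \<circ> f) \<circ> chart_inv \<kappa>) differentiable at (snd \<kappa> p)"
    using chart_rep_compose[OF M N f \<kappa> \<mu> diff_atD_deriv[OF f \<kappa> \<mu>]
        diff_atD_deriv[OF g \<mu> \<nu>[unfolded comp_apply]]]
    unfolding differentiable_def comp_assoc by blast
qed

lemma differential_compose:
  assumes M: "charted M" and N: "charted N" and f: "diff_at M N f p" and g: "diff_at N P g (f p)"
  shows "differential M P (g \<circ> f) p v = differential N P g (f p) (differential M N f p v)"
proof
  fix \<nu>
  \<comment> \<open>These are the charts chosen inside \<open>differential\<close>; naming them lets
    its definition unfold to an ordinary derivative.\<close>
  define \<kappa> where "\<kappa> = (SOME \<kappa>. \<kappa> \<in> charts_at M p)"
  define \<mu> where "\<mu> = (SOME \<mu>. \<mu> \<in> charts_at N (f p))"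
  have \<kappa>: "\<kappa> \<in> charts_at M p" and \<mu>: "\<mu> \<in> charts_at N (f p)"
    using some_chart_at[OF M] some_chart_at[OF N] f unfolding diff_at_def \<kappa>_def \<mu>_def by blast+
  show "differential M P (g \<circ> f) p v \<nu> =
      differential N P g (f p) (differential M N f p v) \<nu>"
  proof (cases "\<nu> \<in> charts_at P (g (f p))")
    case True
    have "frechet_derivative (snd \<nu> \<circ> g \<circ> f \<circ> chart_inv \<kappa>) (at (snd \<kappa> p)) =
        frechet_derivative (snd \<nu> \<circ> g \<circ> chart_inv \<mu>) (at (snd \<mu> (f p))) \<circ>
        frechet_derivative (snd \<mu> \<circ> f \<circ> chart_inv \<kappa>) (at (snd \<kappa> p))"
      by (intro frechet_derivative_at[symmetric] chart_rep_compose[OF M N f \<kappa> \<mu>] diff_atD_deriv[OF f \<kappa> \<mu>] diff_atD_deriv[OF g \<mu> True])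
    then show ?thesis
      using True \<mu>
      by (simp add: differential_def Let_def \<kappa>_def[symmetric] \<mu>_def[symmetric] comp_assoc)
  qed (simp add: differential_def Let_def)
qed


section \<open>Tangent vectors\<close>

lemma chart_transition_has_derivative:
  assumes N: "smooth_manifold N" and "\<kappa> \<in> charts_at N p" "\<mu> \<in> charts_at N p"
  shows "(snd \<mu> \<circ> chart_inv \<kappa> has_derivative
    frechet_derivative (snd \<mu> \<circ> chart_inv \<kappa>) (at (snd \<kappa> p))) (at (snd \<kappa> p))"
proof -
  have "\<kappa> \<in> charts N" "\<mu> \<in> charts N" "snd \<kappa> p \<in> snd \<kappa> ` (fst \<kappa> \<inter> fst \<mu>)"
    using assms(2,3) unfolding charts_at_def by auto
  then have "(snd \<mu> \<circ> chart_inv \<kappa>) differentiable (at (snd \<kappa> p))"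
    using N smooth_on_differentiable unfolding smooth_manifold_def by blast
  then show ?thesis
    by (simp add: frechet_derivative_works)
qed

lemma diff_at_id:
  assumes "smooth_manifold N" "p \<in> points N"
  shows "diff_at N N (\<lambda>x. x) p"
  unfolding diff_at_def
proof (intro conjI allI impI ballI)
  fix \<kappa> \<mu> assume "\<kappa> \<in> charts_at N p" "\<mu> \<in> charts_at N p"
  then show "(snd \<mu> \<circ> (\<lambda>x. x) \<circ> chart_inv \<kappa>) differentiable (at (snd \<kappa> p))"
    using chart_transition_has_derivative[OF assms(1), of \<kappa> p \<mu>]
    unfolding differentiable_def comp_def by blast
qed (use assms(2) in auto)

text \<open>A change of coordinates is the identity map read in two charts, so this is the chain
  rule for the identity.\<close>

lemma chart_change_has_derivative:
  assumes N: "smooth_manifold N" and \<kappa>: "\<kappa> \<in> charts_at N p" and \<mu>: "\<mu> \<in> charts_at N p"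
    and D: "(k \<circ> chart_inv \<mu> has_derivative D) (at (snd \<mu> p))"
  shows "(k \<circ> chart_inv \<kappa> has_derivative
    D \<circ> frechet_derivative (snd \<mu> \<circ> chart_inv \<kappa>) (at (snd \<kappa> p))) (at (snd \<kappa> p))"
proof -
  have c: "charted N"
    using N by (rule smooth_manifold_imp_charted)
  have "p \<in> points N"
    using is_chart_subset[OF charts_atD(1)[OF c \<kappa>]] charts_atD(3)[OF c \<kappa>] by blast
  then have d: "diff_at N N (\<lambda>x. x) p"
    by (rule diff_at_id[OF N])
  have "(snd \<mu> \<circ> (\<lambda>x. x) \<circ> chart_inv \<kappa> has_derivative
      frechet_derivative (snd \<mu> \<circ> chart_inv \<kappa>) (at (snd \<kappa> p))) (at (snd \<kappa> p))"
    using chart_transition_has_derivative[OF N \<kappa> \<mu>] by (simp add: comp_def)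
  from chart_rep_compose[OF c c d \<kappa> \<mu> this D] show ?thesis
    by (simp add: comp_def)
qed

lemma tangent_spaceD:
  assumes "v \<in> tangent_space N p" "\<kappa> \<in> charts_at N p" "\<mu> \<in> charts_at N p"
  shows "v \<mu> = frechet_derivative (snd \<mu> \<circ> chart_inv \<kappa>) (at (snd \<kappa> p)) (v \<kappa>)"
  using assms unfolding tangent_space_def by blast

lemma tangent_space_outside:
  assumes "v \<in> tangent_space N p" "\<kappa> \<notin> charts_at N p" shows "v \<kappa> = 0"
  using assms unfolding tangent_space_def by blast

text \<open>The transformation rule recovers every component from one of them; equality of families
  is therefore tested in a single chart.\<close>

lemma tangent_vec_eqI:
  assumes "v \<in> tangent_space N p" "w \<in> tangent_space N p" "\<kappa> \<in> charts_at N p" "v \<kappa> = w \<kappa>"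
  shows "v = w"
proof
  fix \<mu> show "v \<mu> = w \<mu>"
    using tangent_spaceD[OF assms(1,3), of \<mu>] tangent_spaceD[OF assms(2,3), of \<mu>]
      tangent_space_outside[OF assms(1), of \<mu>] tangent_space_outside[OF assms(2), of \<mu>] assms(4)
    by (cases "\<mu> \<in> charts_at N p") simp_all
qed

text \<open>The two-term form is that of the linearity clause in \<open>riemannian_manifold\<close>,
  so that vectors, differentials and the metric are all expanded by lemmas of one shape.\<close>

lemma tangent_space_lincomb:
  assumes N: "smooth_manifold N" and v: "v \<in> tangent_space N p" and w: "w \<in> tangent_space N p"
  shows "(\<lambda>\<kappa>. a *\<^sub>R v \<kappa> + b *\<^sub>R w \<kappa>) \<in> tangent_space N p"
  unfolding tangent_space_def
proof (intro CollectI conjI ballI allI impI)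
  fix \<kappa> \<mu> assume \<kappa>: "\<kappa> \<in> charts_at N p" and \<mu>: "\<mu> \<in> charts_at N p"
  have "linear (frechet_derivative (snd \<mu> \<circ> chart_inv \<kappa>) (at (snd \<kappa> p)))"
    using chart_transition_has_derivative[OF N \<kappa> \<mu>] by (rule has_derivative_linear)
  then show "a *\<^sub>R v \<mu> + b *\<^sub>R w \<mu> =
      frechet_derivative (snd \<mu> \<circ> chart_inv \<kappa>) (at (snd \<kappa> p)) (a *\<^sub>R v \<kappa> + b *\<^sub>R w \<kappa>)"
    using tangent_spaceD[OF v \<kappa> \<mu>] tangent_spaceD[OF w \<kappa> \<mu>] by (simp add: linear_add linear_scale)
qed (simp add: tangent_space_outside[OF v] tangent_space_outside[OF w])

lemma tangent_space_zero:
  assumes N: "smooth_manifold N" shows "(\<lambda>_. 0) \<in> tangent_space N p"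
  unfolding tangent_space_def
proof (intro CollectI conjI ballI allI impI)
  fix \<kappa> \<mu> assume "\<kappa> \<in> charts_at N p" "\<mu> \<in> charts_at N p"
  then show "0 = frechet_derivative (snd \<mu> \<circ> chart_inv \<kappa>) (at (snd \<kappa> p)) 0"
    using chart_transition_has_derivative[OF N] has_derivative_linear linear_0 by metis
qed simp

text \<open>Compatibility of the components is the chain rule for two successive coordinate changes.
  Together with \<open>coord_vec_self\<close> this supplies a tangent vector with any prescribed
  component in one chart.\<close>

lemma coord_vec_in_tangent_space:
  assumes N: "smooth_manifold N" and \<kappa>: "\<kappa> \<in> charts_at N p"
  shows "coord_vec N \<kappa> p e \<in> tangent_space N p"
  unfolding tangent_space_def
proof (intro CollectI conjI ballI allI impI)
  fix \<mu> \<nu> assume \<mu>: "\<mu> \<in> charts_at N p" and \<nu>: "\<nu> \<in> charts_at N p"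
  show "coord_vec N \<kappa> p e \<nu> =
      frechet_derivative (snd \<nu> \<circ> chart_inv \<mu>) (at (snd \<mu> p)) (coord_vec N \<kappa> p e \<mu>)"
    using frechet_derivative_at[OF chart_change_has_derivative[OF N \<kappa> \<mu>
          chart_transition_has_derivative[OF N \<mu> \<nu>]], symmetric] \<mu> \<nu>
    by (simp add: coord_vec_def)
qed (simp add: coord_vec_def)

lemma coord_vec_self:
  assumes N: "smooth_manifold N" and \<kappa>: "\<kappa> \<in> charts_at N p"
  shows "coord_vec N \<kappa> p e \<kappa> = e"
proof -
  have c: "charted N"
    using N by (rule smooth_manifold_imp_charted)
  have k: "is_chart (mtop N) \<kappa>" "p \<in> fst \<kappa>"
    using charts_atD[OF c \<kappa>] by blast+
  have ev: "\<forall>\<^sub>F y in nhds (snd \<kappa> p). y = (snd \<kappa> \<circ> chart_inv \<kappa>) y"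
    using eventually_chart_inv[OF k openin_topspace subsetD[OF is_chart_subset[OF k(1)] k(2)]]
    by (rule eventually_mono) simp
  then have "\<forall>\<^sub>F y in at (snd \<kappa> p). y = (snd \<kappa> \<circ> chart_inv \<kappa>) y"
    unfolding eventually_at_filter by (rule eventually_mono) simp
  with has_derivative_ident
  have "(snd \<kappa> \<circ> chart_inv \<kappa> has_derivative (\<lambda>x. x)) (at (snd \<kappa> p))"
    using eventually_nhds_x_imp_x[OF ev] by (rule has_derivative_transform_eventually) simp
  then show ?thesis
    using frechet_derivative_at[symmetric] \<kappa> by (fastforce simp: coord_vec_def)
qed

lemma differential_in_tangent_space:
  assumes M: "charted M" and N: "smooth_manifold N" and f: "diff_at M N f p"
  shows "differential M N f p v \<in> tangent_space N (f p)"
  unfolding tangent_space_def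
proof (intro CollectI conjI ballI allI impI)
  fix \<mu> \<nu> assume \<mu>: "\<mu> \<in> charts_at N (f p)" and \<nu>: "\<nu> \<in> charts_at N (f p)"
  define \<kappa> where "\<kappa> = (SOME \<kappa>. \<kappa> \<in> charts_at M p)"
  have \<kappa>: "\<kappa> \<in> charts_at M p"
    using some_chart_at[OF M diff_at_points(1)[OF f]] unfolding \<kappa>_def .
  have "frechet_derivative (snd \<nu> \<circ> f \<circ> chart_inv \<kappa>) (at (snd \<kappa> p)) =
      frechet_derivative (snd \<nu> \<circ> chart_inv \<mu>) (at (snd \<mu> (f p))) \<circ>
      frechet_derivative (snd \<mu> \<circ> f \<circ> chart_inv \<kappa>) (at (snd \<kappa> p))"
    by (intro frechet_derivative_at[symmetric] diff_atD_deriv[OF f \<kappa> \<mu>]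
        chart_rep_compose[OF M smooth_manifold_imp_charted[OF N] f \<kappa> \<mu>]
        chart_transition_has_derivative[OF N \<mu> \<nu>])
  then show "differential M N f p v \<nu> = frechet_derivative (snd \<nu> \<circ> chart_inv \<mu>)
      (at (snd \<mu> (f p))) (differential M N f p v \<mu>)"
    using \<mu> \<nu> by (simp add: differential_def Let_def \<kappa>_def[symmetric])
qed (simp add: differential_def Let_def)

lemma differential_lincomb:
  assumes M: "charted M" and f: "diff_at M N f p"
  shows "differential M N f p (\<lambda>\<kappa>. a *\<^sub>R v \<kappa> + b *\<^sub>R w \<kappa>) =
    (\<lambda>\<mu>. a *\<^sub>R differential M N f p v \<mu> + b *\<^sub>R differential M N f p w \<mu>)"
proof
  fix \<mu>
  define \<kappa> where "\<kappa> = (SOME \<kappa>. \<kappa> \<in> charts_at M p)"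
  have \<kappa>: "\<kappa> \<in> charts_at M p"
    using some_chart_at[OF M diff_at_points(1)[OF f]] unfolding \<kappa>_def .
  show "differential M N f p (\<lambda>\<kappa>. a *\<^sub>R v \<kappa> + b *\<^sub>R w \<kappa>) \<mu> =
    a *\<^sub>R differential M N f p v \<mu> + b *\<^sub>R differential M N f p w \<mu>"
  proof (cases "\<mu> \<in> charts_at N (f p)")
    case True
    show ?thesis
      using has_derivative_linear[OF diff_atD_deriv[OF f \<kappa> True]] True
      by (simp add: differential_def Let_def \<kappa>_def[symmetric] linear_add linear_scale)
  qed (simp add: differential_def Let_def)
qed

lemma differential_zero:
  assumes "charted M" "diff_at M N f p"
  shows "differential M N f p (\<lambda>_. 0) = (\<lambda>_. 0)"
  using differential_lincomb[OF assms, of 0 "\<lambda>_. 0" 0 "\<lambda>_. 0"] by simp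


section \<open>Curves and products\<close>

text \<open>The only chart of \<open>euclidean_mfd\<close> is \<open>(UNIV, id)\<close>; at every
  other pair the family has to be 0, as everywhere off the charts around a point.\<close>

definition euclidean_vec :: "'e::euclidean_space \<Rightarrow> ('e, 'e) tvec" where
  "euclidean_vec e = (\<lambda>\<kappa>. if \<kappa> = (UNIV, id) then e else 0)"

lemma euclidean_vec_in_tangent_space: "euclidean_vec e \<in> tangent_space euclidean_mfd x"
  by (simp add: tangent_space_def euclidean_vec_def)

lemma diff_at_euclidean:
  assumes "f differentiable (at x)" shows "diff_at euclidean_mfd euclidean_mfd f x"
  unfolding diff_at_def
proof (intro conjI allI impI ballI)
  fix U assume "openin (mtop euclidean_mfd) U \<and> f x \<in> U"
  then have "\<forall>\<^sub>F y in nhds x. f y \<in> U"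
    using differentiable_imp_continuous_within[OF assms] 
    by (metis continuous_within eventually_nhds openin_euclidean_mfd tendsto_at_iff_tendsto_nhds tendsto_def)
  then show "\<exists>V. openin (mtop euclidean_mfd) V \<and> x \<in> V \<and> f ` V \<subseteq> U"
    unfolding eventually_nhds by auto
qed (use assms in auto)

lemma diff_at_const:
  assumes "charted M" "p \<in> points M" "q \<in> points N"
  shows "diff_at M N (\<lambda>_. q) p"
  unfolding diff_at_def
proof (intro conjI allI impI ballI)
  fix U assume "openin (mtop N) U \<and> q \<in> U"
  then show "\<exists>V. openin (mtop M) V \<and> p \<in> V \<and> (\<lambda>_. q) ` V \<subseteq> U"
    using assms(2) by (intro exI[of _ "points M"]) auto
qed (use assms in \<open>auto simp: comp_def\<close>)

lemma diff_at_Pair: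
  assumes f: "diff_at P M f p" and g: "diff_at P N g p"
  shows "diff_at P (prod_mfd M N) (\<lambda>x. (f x, g x)) p"
  unfolding diff_at_def
proof (intro conjI allI impI ballI)
  show "p \<in> points P" "(f p, g p) \<in> points (prod_mfd M N)"
    using diff_at_points[OF f] diff_at_points[OF g] by (auto simp: prod_mfd_def)
next
  fix U assume "openin (mtop (prod_mfd M N)) U \<and> (f p, g p) \<in> U"
  then obtain A B where A: "openin (mtop M) A" "f p \<in> A" and B: "openin (mtop N) B" "g p \<in> B"
    and AB: "A \<times> B \<subseteq> U"
    unfolding prod_mfd_def mfd.simps openin_prod_topology_alt by blast
  obtain V where V: "openin (mtop P) V" "p \<in> V" "f ` V \<subseteq> A"
    using diff_atD_top[OF f A] .
  obtain W where W: "openin (mtop P) W" "p \<in> W" "g ` W \<subseteq> B"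
    using diff_atD_top[OF g B] .
  show "\<exists>V. openin (mtop P) V \<and> p \<in> V \<and> (\<lambda>x. (f x, g x)) ` V \<subseteq> U"
    using V W AB by (intro exI[of _ "V \<inter> W"]) auto
next
  fix \<kappa> \<xi> assume \<kappa>: "\<kappa> \<in> charts_at P p" and "\<xi> \<in> charts_at (prod_mfd M N) (f p, g p)"
  then obtain \<mu> \<nu> where \<mu>: "\<mu> \<in> charts_at M (f p)" and \<nu>: "\<nu> \<in> charts_at N (g p)"
    and \<xi>: "\<xi> = (fst \<mu> \<times> fst \<nu>, map_prod (snd \<mu>) (snd \<nu>))"
    unfolding prod_mfd_def charts_at_def mfd.simps mem_Collect_eq by fastforce
  have "(\<lambda>y. ((snd \<mu> \<circ> f \<circ> chart_inv \<kappa>) y, (snd \<nu> \<circ> g \<circ> chart_inv \<kappa>) y))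
      differentiable (at (snd \<kappa> p))"
    using diff_atD_deriv[OF f \<kappa> \<mu>] diff_atD_deriv[OF g \<kappa> \<nu>] has_derivative_Pair
    unfolding differentiable_def by blast
  then show "(snd \<xi> \<circ> (\<lambda>x. (f x, g x)) \<circ> chart_inv \<kappa>) differentiable (at (snd \<kappa> p))"
    by (simp add: \<xi> comp_def)
qed

text \<open>With velocities expressed as differentials, the chain rule for maps also covers
  curves.\<close>

lemma velocity_eq_differential:
  assumes c: "diff_at euclidean_mfd N c t"
  shows "velocity N c t = differential euclidean_mfd N c t (euclidean_vec 1)"
proof
  fix \<mu>
  have "vector_derivative (snd \<mu> \<circ> c) (at t) = frechet_derivative (snd \<mu> \<circ> c) (at t) 1"
    if "\<mu> \<in> charts_at N (c t)"
  proof -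
    have "(snd \<mu> \<circ> c) differentiable (at t)"
      using diff_atD_deriv[OF c _ that] unfolding differentiable_def by (auto simp: inv_id)
    then show ?thesis
      by (simp add: frechet_derivative_eq_vector_derivative)
  qed
  then show "velocity N c t \<mu> = differential euclidean_mfd N c t (euclidean_vec 1) \<mu>"
    by (simp add: velocity_def differential_def Let_def euclidean_vec_def inv_id)
qed

lemma velocity_in_tangent_space:
  assumes "smooth_manifold N" "diff_at euclidean_mfd N c t"
  shows "velocity N c t \<in> tangent_space N (c t)"
  using assms by (simp add: velocity_eq_differential differential_in_tangent_space charted_euclidean)

lemma velocity_compose:
  assumes M: "charted M" and c: "diff_at euclidean_mfd M c t" and f: "diff_at M N f (c t)"
  shows "velocity N (f \<circ> c) t = differential M N f (c t) (velocity M c t)"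
  using velocity_eq_differential[OF c] diff_at_compose[OF charted_euclidean M c f]
    differential_compose[OF charted_euclidean M c f]
  by (simp add: velocity_eq_differential)

lemma velocity_euclidean:
  "velocity euclidean_mfd c t = euclidean_vec (vector_derivative c (at t))"
  by (auto simp: velocity_def euclidean_vec_def)

lemma velocity_const: "velocity N (\<lambda>_. q) t = (\<lambda>_. 0)"
  by (auto simp: velocity_def comp_def)

text \<open>The filter is \<open>nhds\<close>, not \<open>at\<close>: the curves must agree at
  \<open>t\<close> itself, because the point decides which charts carry components.\<close>

lemma velocity_cong:
  fixes N :: "('a, 'e::euclidean_space) mfd"
  assumes "\<forall>\<^sub>F s in nhds t. c s = d s" shows "velocity N c t = velocity N d t"
proof
  fix \<kappa> :: "('a, 'e) chart"
  have "\<forall>\<^sub>F s in nhds t. s \<in> UNIV \<longrightarrow> (snd \<kappa> \<circ> c) s = (snd \<kappa> \<circ> d) s"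
    using assms by (rule eventually_mono) simp
  then have "vector_derivative (snd \<kappa> \<circ> c) (at t) = vector_derivative (snd \<kappa> \<circ> d) (at t)"
    by (intro vector_derivative_cong_eq) auto
  then show "velocity N c t \<kappa> = velocity N d t \<kappa>"
    using eventually_nhds_x_imp_x[OF assms] by (simp add: velocity_def)
qed

text \<open>A single chart need not contain the whole curve. Around each parameter the curve is
  constant in one chart, and charts are injective; connectedness of \<open>J\<close> passes from
  local to global constancy. This serves both for fixed points of the flow and for curves projected
  to the orbit space.\<close>

lemma velocity_zero_imp_constant:
  fixes c :: "real \<Rightarrow> 'a"
  assumes N: "charted N" and J: "open J" "connected J"
    and c: "\<And>t. t \<in> J \<Longrightarrow> diff_at euclidean_mfd N c t"
    and zero: "\<And>t. t \<in> J \<Longrightarrow> velocity N c t = (\<lambda>_. 0)"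
    and st: "s \<in> J" "t \<in> J"
  shows "c s = c t"
proof (rule connected_local_const[OF J(2) st])
  show "\<forall>a\<in>J. \<forall>\<^sub>F b in at a within J. c a = c b"
  proof
    fix a assume a: "a \<in> J"
    obtain \<kappa> where \<kappa>: "\<kappa> \<in> charts_at N (c a)"
      using charts_at_nonempty[OF N diff_at_points(2)[OF c[OF a]]] .
    note k = charts_atD[OF N \<kappa>]
    obtain V where V: "open V" "a \<in> V" "c ` V \<subseteq> fst \<kappa>"
      using diff_atD_top[OF c[OF a], of "fst \<kappa>"] k unfolding is_chart_def by auto
    obtain r where r: "0 < r" "ball a r \<subseteq> V \<inter> J"
      using open_contains_ball_eq[of "V \<inter> J" a] V J(1) a by auto
    have "((snd \<kappa> \<circ> c) has_derivative (\<lambda>h. 0)) (at b within ball a r)" if b: "b \<in> ball a r" for b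
    proof -
      have bJ: "b \<in> J" and "b \<in> V"
        using b r(2) by auto
      then have kb: "\<kappa> \<in> charts_at N (c b)"
        using V(3) k(2) by (auto simp: charts_at_def)
      have "(snd \<kappa> \<circ> c) differentiable (at b)"
        using diff_atD_deriv[OF c[OF bJ] _ kb] unfolding differentiable_def by (auto simp: inv_id)
      then have "((snd \<kappa> \<circ> c) has_vector_derivative vector_derivative (snd \<kappa> \<circ> c) (at b)) (at b)"
        by (simp add: vector_derivative_works)
      moreover have "vector_derivative (snd \<kappa> \<circ> c) (at b) = 0"
        using fun_cong[OF zero[OF bJ], of \<kappa>] kb by (simp add: velocity_def)
      ultimately show ?thesis
        by (simp add: has_vector_derivative_def has_derivative_at_withinI)
    qed
    then have const: "(snd \<kappa> \<circ> c) b = (snd \<kappa> \<circ> c) a" if "b \<in> ball a r" for b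
      using has_derivative_zero_unique[OF convex_ball, of a r "snd \<kappa> \<circ> c" a b] that r(1) by auto
    have "c a = c b" if "b \<in> ball a r" for b
    proof -
      have "c b \<in> fst \<kappa>"
        using that r(2) V(3) by blast
      then show ?thesis
        using const[OF that] inj_onD[OF is_chart_inj_on[OF k(1)], of "c a" "c b"] k(3) by simp
    qed
    then show "\<forall>\<^sub>F b in at a within J. c a = c b"
      using r(1) unfolding eventually_at by (intro exI[of _ r]) (auto simp: dist_commute)
  qed
qed

text \<open>The homeomorphism gives continuity of the inverse, the injective differential gives a
  linear left inverse of the derivative, and the two together give differentiability of the inverse
  at the point. Hence the coordinates of a curve in \<open>M\<close> are differentiable functions of
  its parameter.\<close>

lemma regular_parametrization_inverse_differentiable:
  assumes M: "smooth_manifold M" and W: "open W" and \<Psi>: "regular_parametrization M W \<Psi>"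
    and c: "diff_at euclidean_mfd M c s" and cs: "c s \<in> \<Psi> ` W"
  shows "(inv_into W \<Psi> \<circ> c) differentiable (at s)"
proof -
  have Mc: "charted M"
    using M by (rule smooth_manifold_imp_charted)
  have smooth: "smooth_map_on W euclidean_mfd M \<Psi>" and op: "openin (mtop M) (\<Psi> ` W)"
    and hom: "homeomorphic_map (top_of_set W) (subtopology (mtop M) (\<Psi> ` W)) \<Psi>"
    and inj: "\<And>w. w \<in> W \<Longrightarrow> inj_on (differential euclidean_mfd M \<Psi> w) (tangent_space euclidean_mfd w)"
    using \<Psi> unfolding regular_parametrization_def prod_mfd_euclidean by auto
  have inj\<Psi>: "inj_on \<Psi> W"
    using homeomorphic_imp_injective_map[OF hom] by simp
  define w where "w = inv_into W \<Psi> (c s)"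
  have w: "w \<in> W" "\<Psi> w = c s"
    using cs by (simp_all add: w_def inv_into_into f_inv_into_f)
  have d: "diff_at euclidean_mfd M \<Psi> w"
    by (rule smooth_map_on_diff_at[OF smooth w(1)])
  obtain \<kappa> where \<kappa>: "\<kappa> \<in> charts_at M (c s)"
    using charts_at_nonempty[OF Mc diff_at_points(2)[OF c]] .
  note k = charts_atD[OF Mc \<kappa>]
  define D where "D = frechet_derivative (snd \<kappa> \<circ> \<Psi>) (at w)"
  have D: "(snd \<kappa> \<circ> \<Psi> has_derivative D) (at w)"
    using diff_atD_deriv[OF d, of "(UNIV, id)" \<kappa>] \<kappa> w(2) by (simp add: inv_id D_def)
  \<comment> \<open>Injectivity is known for the differential on families of components. It is
    carried over to the coordinate derivative by comparing the images of
    \<open>euclidean_vec e\<close> and \<open>euclidean_vec 0\<close>.\<close>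
  have "inj D"
  proof (rule linear_injective_0[OF has_derivative_linear[OF D], THEN iffD2], intro allI impI)
    fix e assume e: "D e = 0"
    have "differential euclidean_mfd M \<Psi> w (euclidean_vec e) = (\<lambda>_. 0)"
    proof (rule tangent_vec_eqI)
      show "differential euclidean_mfd M \<Psi> w (euclidean_vec e) \<in> tangent_space M (\<Psi> w)"
        by (rule differential_in_tangent_space[OF charted_euclidean M d])
      show "(\<lambda>_. 0) \<in> tangent_space M (\<Psi> w)"
        by (rule tangent_space_zero[OF M])
      show "differential euclidean_mfd M \<Psi> w (euclidean_vec e) \<kappa> = 0"
        using e \<kappa> w(2) by (simp add: differential_def Let_def inv_id D_def euclidean_vec_def)
      show "\<kappa> \<in> charts_at M (\<Psi> w)"
        using \<kappa> w(2) by simp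
    qed
    also have "\<dots> = differential euclidean_mfd M \<Psi> w (euclidean_vec 0)"
      using differential_zero[OF charted_euclidean d] by (simp add: euclidean_vec_def)
    finally have "euclidean_vec e = euclidean_vec 0"
      using inj_onD[OF inj[OF w(1)]] euclidean_vec_in_tangent_space by blast
    then show "e = 0"
      unfolding euclidean_vec_def by (metis (full_types))
  qed
  then obtain D' where D': "linear D'" "D' \<circ> D = id"
    using linear_injective_left_inverse has_derivative_linear[OF D] by blast
  define G where "G = inv_into W \<Psi> \<circ> chart_inv \<kappa>"
  have G: "G (snd \<kappa> (c s)) = w"
    using chart_inv_left[OF k(1) k(3)] by (simp add: G_def w_def)
  have "(G has_derivative D') (at (snd \<kappa> (c s)))"
  proof (rule has_derivative_inverse_basic)
    show "(snd \<kappa> \<circ> \<Psi> has_derivative D) (at (G (snd \<kappa> (c s))))"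
      using D G by simp
    show "bounded_linear D'"
      using D'(1) by (simp add: linear_conv_bounded_linear)
    show "D' \<circ> D = id" by fact
    show "open (snd \<kappa> ` (fst \<kappa> \<inter> \<Psi> ` W))"
      by (rule is_chart_open_image[OF k(1) op])
    show "snd \<kappa> (c s) \<in> snd \<kappa> ` (fst \<kappa> \<inter> \<Psi> ` W)"
      using k(3) cs by blast
    show "(snd \<kappa> \<circ> \<Psi>) (G z) = z" if z: "z \<in> snd \<kappa> ` (fst \<kappa> \<inter> \<Psi> ` W)" for z
    proof -
      obtain q where q: "z = snd \<kappa> q" "q \<in> fst \<kappa>" "q \<in> \<Psi> ` W"
        using z by blast
      then show ?thesis
        using f_inv_into_f[OF q(3)] by (simp add: G_def chart_inv_left[OF k(1)])
    qed
    \<comment> \<open>\<open>\<Psi>\<close> is open onto its image, which is open in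
      \<open>M\<close>, so it maps a neighbourhood of \<open>w\<close> to an open set of
      \<open>M\<close>; the chart turns this into a neighbourhood of coordinates.\<close>
    show "continuous (at (snd \<kappa> (c s))) G"
      unfolding continuous_at_open
    proof (intro allI impI)
      fix V assume V: "open V \<and> G (snd \<kappa> (c s)) \<in> V"
      have "openin (top_of_set W) (W \<inter> V)"
        using V by (simp add: openin_open_Int)
      then have "openin (subtopology (mtop M) (\<Psi> ` W)) (\<Psi> ` (W \<inter> V))"
        using homeomorphic_imp_open_map[OF hom] unfolding open_map_def by blast
      then have o: "openin (mtop M) (\<Psi> ` (W \<inter> V))"
        using op openin_trans_full by blast
      have m: "c s \<in> \<Psi> ` (W \<inter> V)"
        using w V G by (metis IntI imageI)
      have "\<forall>\<^sub>F z in nhds (snd \<kappa> (c s)). G z \<in> V"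
        using eventually_chart_inv[OF k(1) k(3) o m]
        by eventually_elim (use inj\<Psi> in \<open>auto simp: G_def\<close>)
      then show "\<exists>S. open S \<and> snd \<kappa> (c s) \<in> S \<and> (\<forall>x'\<in>S. G x' \<in> V)"
        unfolding eventually_nhds by blast
    qed
  qed
  from chart_rep_compose[OF charted_euclidean Mc c _ \<kappa> diff_atD_deriv[OF c _ \<kappa>] this[unfolded G_def],
      of "(UNIV, id)"]
  show ?thesis
    unfolding differentiable_def by (auto simp: inv_id)
qed


section \<open>Riemannian metrics\<close>

text \<open>Rank-nullity is encoded by adding the coordinate \<open>z \<bullet> x\<close> to
  \<open>D\<close>. The resulting \<open>T\<close> is onto a space of the same dimension, hence
  injective, and it does not distinguish \<open>y\<close> from its orthogonal projection to the line
  of \<open>x\<close>.\<close>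

lemma linear_surj_kernel_line:
  fixes D :: "'d::euclidean_space \<Rightarrow> 'e::euclidean_space"
  assumes D: "linear D" "surj D" and dim: "DIM('d) = Suc (DIM('e))"
    and x: "x \<noteq> 0" "D x = 0" and y: "D y = 0"
  obtains a where "y = a *\<^sub>R x"
proof -
  define T where "T z = (D z, z \<bullet> x)" for z
  have T: "linear T"
    unfolding T_def using D(1)
    by (intro linearI) (simp_all add: linear_add linear_scale inner_add_left)
  have "surj T"
    unfolding surj_def
  proof
    fix b :: "'e \<times> real"
    obtain z where "D z = fst b"
      using D(2) by (metis surjD)
    then have "b = T (z + ((snd b - z \<bullet> x) / (x \<bullet> x)) *\<^sub>R x)"
      using x D(1) by (simp add: T_def linear_add linear_scale inner_add_left prod_eq_iff)
    then show "\<exists>z. b = T z" ..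
  qed
  then have "inj T"
    using T dim by (intro eucl.linear_surjective_imp_injective) simp_all
  moreover have "T y = T ((y \<bullet> x / (x \<bullet> x)) *\<^sub>R x)"
    using x y D(1) by (simp add: T_def linear_scale)
  ultimately show thesis
    using that by (meson injD)
qed

locale riemannian =
  fixes N :: "('a, 'e::euclidean_space) mfd" and g :: "('a, 'e) metric_field"
  assumes riemannian: "riemannian_manifold N g"
begin

lemma smooth: "smooth_manifold N"
  using riemannian unfolding riemannian_manifold_def by blast

lemma charted: "charted N"
  by (rule smooth_manifold_imp_charted[OF smooth])

lemma metric_sym:
  assumes "p \<in> points N" "v \<in> tangent_space N p" "w \<in> tangent_space N p"
  shows "g p v w = g p w v"
  using riemannian assms unfolding riemannian_manifold_def by blast

lemma metric_lincomb_left: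
  assumes "p \<in> points N" "v \<in> tangent_space N p" "w \<in> tangent_space N p" "z \<in> tangent_space N p"
  shows "g p (\<lambda>\<kappa>. a *\<^sub>R v \<kappa> + b *\<^sub>R w \<kappa>) z = a * g p v z + b * g p w z"
  using riemannian assms unfolding riemannian_manifold_def by blast

lemma metric_lincomb_right:
  assumes "p \<in> points N" "v \<in> tangent_space N p" "w \<in> tangent_space N p" "z \<in> tangent_space N p"
  shows "g p z (\<lambda>\<kappa>. a *\<^sub>R v \<kappa> + b *\<^sub>R w \<kappa>) = a * g p z v + b * g p z w"
  using metric_sym[OF assms(1,4) tangent_space_lincomb[OF smooth assms(2,3)]]
    metric_lincomb_left[OF assms] metric_sym[OF assms(1,2,4)] metric_sym[OF assms(1,3,4)] by simp

lemma metric_quadratic: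
  assumes "p \<in> points N" "v \<in> tangent_space N p" "w \<in> tangent_space N p"
  shows "g p (\<lambda>\<kappa>. a *\<^sub>R v \<kappa> + b *\<^sub>R w \<kappa>) (\<lambda>\<kappa>. a *\<^sub>R v \<kappa> + b *\<^sub>R w \<kappa>) =
    a\<^sup>2 * g p v v + 2 * a * b * g p v w + b\<^sup>2 * g p w w"
  using metric_lincomb_left[OF assms tangent_space_lincomb[OF smooth assms(2,3)]]
    metric_lincomb_right[OF assms(1-3)] metric_sym[OF assms] assms(2,3)
  by (simp add: algebra_simps power2_eq_square)

lemma metric_pos:
  assumes "p \<in> points N" "v \<in> tangent_space N p" "v \<noteq> (\<lambda>_. 0)"
  shows "0 < g p v v"
  using riemannian assms unfolding riemannian_manifold_def by blast

lemma metric_zero: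
  assumes "p \<in> points N"
  shows "g p (\<lambda>_. 0) (\<lambda>_. 0) = 0"
  using metric_lincomb_left[OF assms tangent_space_zero[OF smooth] tangent_space_zero[OF smooth]
      tangent_space_zero[OF smooth], of 0 0] by simp

lemma metric_nonneg:
  assumes "p \<in> points N" "v \<in> tangent_space N p"
  shows "0 \<le> g p v v"
  using metric_pos[OF assms] metric_zero[OF assms(1)] by (cases "v = (\<lambda>_. 0)") auto

text \<open>Smoothness of the metric is available only for its coefficients in coordinate vectors;
  the expansion carries it over to arbitrary tangent vectors.\<close>

lemma metric_expand:
  assumes p: "p \<in> points N" and \<kappa>: "\<kappa> \<in> charts_at N p"
    and v: "v \<in> tangent_space N p" and w: "w \<in> tangent_space N p"
  shows "g p v w = (\<Sum>i\<in>Basis. \<Sum>j\<in>Basis.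
    (v \<kappa> \<bullet> i) * (w \<kappa> \<bullet> j) * g p (coord_vec N \<kappa> p i) (coord_vec N \<kappa> p j))"
proof -
  have T: "coord_vec N \<kappa> p d \<in> tangent_space N p" for d
    by (rule coord_vec_in_tangent_space[OF smooth \<kappa>])
  \<comment> \<open>Both sides are tangent vectors with the same component in
    \<open>\<kappa>\<close>, so linearity of \<open>coord_vec\<close> follows from uniqueness
    without any derivative.\<close>
  have comb: "coord_vec N \<kappa> p (a *\<^sub>R d + b *\<^sub>R e) =
      (\<lambda>\<mu>. a *\<^sub>R coord_vec N \<kappa> p d \<mu> + b *\<^sub>R coord_vec N \<kappa> p e \<mu>)" for a b d e
    using T tangent_space_lincomb[OF smooth T T]
    by (intro tangent_vec_eqI[OF _ _ \<kappa>]) (simp_all add: coord_vec_self[OF smooth \<kappa>])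
  have self: "coord_vec N \<kappa> p (u \<kappa>) = u" if "u \<in> tangent_space N p" for u
    using T that by (intro tangent_vec_eqI[OF _ _ \<kappa>]) (simp_all add: coord_vec_self[OF smooth \<kappa>])
  define B where "B d e = g p (coord_vec N \<kappa> p d) (coord_vec N \<kappa> p e)" for d e
  have B0: "B (a *\<^sub>R d + b *\<^sub>R d') e = a * B d e + b * B d' e" for a b d d' e
    unfolding B_def comb by (rule metric_lincomb_left[OF p T T T])
  have B1: "linear (\<lambda>d. B d e)" for e
  proof (rule linearI)
    show "B (d + d') e = B d e + B d' e" for d d'
      using B0[of 1 d 1 d' e] by simp
    show "B (r *\<^sub>R d) e = r *\<^sub>R B d e" for r d
      using B0[of r d 0 d e] by simp
  qed
  have B2: "linear (\<lambda>e. B d e)" for d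
    using B1[of d] metric_sym[OF p T T] unfolding B_def by simp
  have "g p v w = B (v \<kappa>) (w \<kappa>)"
    by (simp add: B_def self[OF v] self[OF w])
  also have "\<dots> = (\<Sum>i\<in>Basis. (v \<kappa> \<bullet> i) * B i (w \<kappa>))"
    using Linear_Algebra.linear_componentwise[OF B1[of "w \<kappa>"], of "v \<kappa>" 1] by simp
  also have "\<dots> = (\<Sum>i\<in>Basis. \<Sum>j\<in>Basis. (v \<kappa> \<bullet> i) * (w \<kappa> \<bullet> j) * B i j)"
    using Linear_Algebra.linear_componentwise[OF B2, of _ "w \<kappa>" 1] by (simp add: sum_distrib_left mult.assoc)
  finally show ?thesis
    unfolding B_def .
qed

section \<open>Continuity of the metric along a curve\<close>

lemma continuous_chart_along_curve:
  assumes c: "diff_at euclidean_mfd N c t" and \<kappa>: "\<kappa> \<in> charts_at N (c t)"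
  shows "isCont (snd \<kappa> \<circ> c) t"
proof -
  have "(snd \<kappa> \<circ> c) differentiable (at t)"
    using diff_atD_deriv[OF c _ \<kappa>] unfolding differentiable_def by (auto simp: inv_id)
  then show ?thesis
    by (rule differentiable_imp_continuous_within)
qed

lemma eventually_charts_at_along_curve:
  assumes c: "diff_at euclidean_mfd N c t" and \<kappa>: "\<kappa> \<in> charts_at N (c t)"
  shows "\<forall>\<^sub>F s in nhds t. \<kappa> \<in> charts_at N (c s)"
proof -
  note k = charts_atD[OF charted \<kappa>]
  obtain V where "openin (mtop euclidean_mfd) V" "t \<in> V" "c ` V \<subseteq> fst \<kappa>"
    using diff_atD_top[OF c, of "fst \<kappa>"] k unfolding is_chart_def by blast
  then show ?thesis
    using k(2) unfolding eventually_nhds charts_at_def by auto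
qed

text \<open>Near \<open>t\<close> the curve stays in the domain of \<open>\<kappa>\<close>, where
  the metric is a finite sum of products of continuous functions. This is the source of the
  continuity of the integrand of \<open>v\<close>.\<close>

lemma continuous_metric_along_curve:
  assumes c: "diff_at euclidean_mfd N c t" and \<kappa>: "\<kappa> \<in> charts_at N (c t)"
    and tangent: "\<forall>\<^sub>F s in nhds t. V s \<in> tangent_space N (c s) \<and> W s \<in> tangent_space N (c s)"
    and V: "isCont (\<lambda>s. V s \<kappa>) t" and W: "isCont (\<lambda>s. W s \<kappa>) t"
  shows "isCont (\<lambda>s. g (c s) (V s) (W s)) t"
proof -
  note k = charts_atD[OF charted \<kappa>]
  define G where "G i j y = g (chart_inv \<kappa> y) (coord_vec N \<kappa> (chart_inv \<kappa> y) i)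
    (coord_vec N \<kappa> (chart_inv \<kappa> y) j)" for i j y
  have G: "isCont (G i j) (snd \<kappa> (c t))" for i j
  proof -
    have "smooth_on (snd \<kappa> ` fst \<kappa>) (G i j)"
      using riemannian k(2) unfolding riemannian_manifold_def G_def by blast
    moreover have "open (snd \<kappa> ` fst \<kappa>)"
      using k(1) unfolding is_chart_def by blast
    ultimately show ?thesis
      using smooth_on_continuous_on continuous_on_eq_continuous_at k(3) by blast
  qed
  have "isCont (\<lambda>s. G i j ((snd \<kappa> \<circ> c) s)) t" for i j
    by (rule isCont_o2[OF continuous_chart_along_curve[OF c \<kappa>]]) (simp add: G)
  then have "isCont (\<lambda>s. \<Sum>i\<in>Basis. \<Sum>j\<in>Basis.
      (V s \<kappa> \<bullet> i) * (W s \<kappa> \<bullet> j) * G i j ((snd \<kappa> \<circ> c) s)) t"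
    using V W by (intro continuous_intros)
  moreover have "\<forall>\<^sub>F s in nhds t. (\<Sum>i\<in>Basis. \<Sum>j\<in>Basis.
      (V s \<kappa> \<bullet> i) * (W s \<kappa> \<bullet> j) * G i j ((snd \<kappa> \<circ> c) s)) = g (c s) (V s) (W s)"
    using tangent eventually_charts_at_along_curve[OF c \<kappa>]
  proof eventually_elim
    case (elim s)
    then have "c s \<in> fst \<kappa>"
      by (simp add: charts_at_def)
    moreover then have "c s \<in> points N"
      using is_chart_subset[OF k(1)] by blast
    ultimately show ?case
      using elim metric_expand[of "c s" \<kappa> "V s" "W s"] by (simp add: G_def chart_inv_left[OF k(1)])
  qed
  ultimately show ?thesis
    by (simp only: isCont_cong)
qed

end


section \<open>Killing flows\<close>

locale killing_flow = riemannian N g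
  for N :: "('a, 'e::euclidean_space) mfd" and g :: "('a, 'e) metric_field" +
  fixes X :: "'a \<Rightarrow> ('a, 'e) tvec" and \<phi> :: "real \<Rightarrow> 'a \<Rightarrow> 'a"
  assumes killing: "killing_field_flow N g X \<phi>"
begin

lemma field_tangent: "p \<in> points N \<Longrightarrow> X p \<in> tangent_space N p"
  using killing unfolding killing_field_flow_def smooth_vector_field_def by blast

lemma flow_points: "p \<in> points N \<Longrightarrow> \<phi> t p \<in> points N"
  by (rule funcset_mem[OF Bij_imp_funcset]) (use killing in \<open>simp_all add: killing_field_flow_def\<close>)

lemma flow_0: "p \<in> points N \<Longrightarrow> \<phi> 0 p = p"
  using killing unfolding killing_field_flow_def by simp

lemma flow_add: "p \<in> points N \<Longrightarrow> \<phi> (s + t) p = \<phi> s (\<phi> t p)"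
  using killing by (simp add: killing_field_flow_def compose_eq)

lemma flow_isometry:
  "p \<in> points N \<Longrightarrow> v \<in> tangent_space N p \<Longrightarrow> w \<in> tangent_space N p \<Longrightarrow>
    g (\<phi> t p) (differential N N (\<phi> t) p v) (differential N N (\<phi> t) p w) = g p v w"
  using killing unfolding killing_field_flow_def by blast

lemma flow_velocity: "p \<in> points N \<Longrightarrow> velocity N (\<lambda>s. \<phi> s p) t = X (\<phi> t p)"
  using killing unfolding killing_field_flow_def by blast

lemma flow_joint_diff_at:
  assumes "p \<in> points N"
  shows "diff_at (prod_mfd euclidean_mfd N) N (\<lambda>(t, p). \<phi> t p) (t, p)"
proof (rule smooth_map_on_diff_at)
  show "smooth_map_on (UNIV \<times> points N) (prod_mfd euclidean_mfd N) N (\<lambda>(t, p). \<phi> t p)"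
    using killing unfolding killing_field_flow_def by blast
qed (use assms in simp)

text \<open>Freezing one argument of the jointly differentiable flow yields differentiability of
  each \<open>\<phi> t\<close> and of each integral curve.\<close>

lemma flow_compose_diff_at:
  assumes P: "charted P" and a: "diff_at P euclidean_mfd a x" and b: "diff_at P N b x"
  shows "diff_at P N (\<lambda>x. \<phi> (a x) (b x)) x"
  using diff_at_compose[OF P charted_prod[OF charted_euclidean charted] diff_at_Pair[OF a b]
      flow_joint_diff_at[OF diff_at_points(2)[OF b]]]
  by (simp add: comp_def)

lemma flow_diff_at: "p \<in> points N \<Longrightarrow> diff_at N N (\<phi> t) p"
  using flow_compose_diff_at[OF charted diff_at_const[OF charted] diff_at_id[OF smooth]] by simp

lemma flow_curve_diff_at: "p \<in> points N \<Longrightarrow> diff_at euclidean_mfd N (\<lambda>s. \<phi> s p) t"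
  using flow_compose_diff_at[OF charted_euclidean diff_at_euclidean[OF differentiable_ident]
      diff_at_const[OF charted_euclidean]] by simp

text \<open>Differentiate \<open>\<phi> t (\<phi> s p) = \<phi> (t + s) p\<close> with respect to
  \<open>s\<close> at 0, once on each side.\<close>

lemma flow_field:
  assumes p: "p \<in> points N"
  shows "differential N N (\<phi> t) p (X p) = X (\<phi> t p)"
proof -
  have d: "diff_at euclidean_mfd N (\<lambda>s. \<phi> s p) u" for u
    by (rule flow_curve_diff_at[OF p])
  have "differential N N (\<phi> t) p (X p) = velocity N (\<phi> t \<circ> (\<lambda>s. \<phi> s p)) 0"
    using velocity_compose[OF charted d flow_diff_at, of 0 t] p flow_velocity[OF p, of 0]
    by (simp add: flow_0)
  also have "\<phi> t \<circ> (\<lambda>s. \<phi> s p) = (\<lambda>s. \<phi> s p) \<circ> (\<lambda>s. t + s)"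
    using p by (auto simp: flow_add)
  also have "velocity N \<dots> 0 =
      differential euclidean_mfd N (\<lambda>s. \<phi> s p) t (velocity euclidean_mfd (\<lambda>s. t + s) 0)"
    using velocity_compose[OF charted_euclidean diff_at_euclidean d, of "\<lambda>s. t + s" 0] by simp
  also have "velocity euclidean_mfd (\<lambda>s. t + s) 0 = euclidean_vec 1"
    unfolding velocity_euclidean
    by (rule arg_cong[where f = euclidean_vec], rule vector_derivative_at)
      (auto intro!: derivative_eq_intros)
  also have "differential euclidean_mfd N (\<lambda>s. \<phi> s p) t \<dots> = X (\<phi> t p)"
    using velocity_eq_differential[OF d, of t] flow_velocity[OF p, of t] by simp
  finally show ?thesis .
qed

text \<open>The flow maps zeros of \<open>X\<close> to zeros, so the integral curve of
  \<open>p\<close> has zero velocity throughout. No uniqueness theorem for differential equations is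
  used.\<close>

lemma flow_fixes_zero:
  assumes p: "p \<in> points N" and zero: "X p = (\<lambda>_. 0)"
  shows "\<phi> t p = p"
proof -
  have "X (\<phi> s p) = (\<lambda>_. 0)" for s
    using flow_field[OF p, of s] differential_zero[OF charted flow_diff_at[OF p]] zero by simp
  then have "\<phi> t p = \<phi> 0 p"
    by (intro velocity_zero_imp_constant[OF charted open_UNIV connected_UNIV, of "\<lambda>s. \<phi> s p"]
        flow_curve_diff_at[OF p]) (simp_all add: flow_velocity[OF p])
  then show ?thesis
    using flow_0[OF p] by simp
qed

section \<open>Orbits, isotropy and zeros of the Killing field\<close>

lemma flow_orbit_eq: "flow_orbit N \<phi> p = range (\<lambda>t. \<phi> t p)"
  by (auto simp: orbit_def flow_group_def)

lemma flow_orbit_self: "p \<in> points N \<Longrightarrow> p \<in> flow_orbit N \<phi> p"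
  unfolding flow_orbit_eq by (metis flow_0 rangeI)

lemma flow_orbit_flow:
  assumes p: "p \<in> points N" shows "flow_orbit N \<phi> (\<phi> t p) = flow_orbit N \<phi> p"
proof -
  have "\<phi> s p = \<phi> (s - t) (\<phi> t p)" "\<phi> s (\<phi> t p) = \<phi> (s + t) p" for s
    using flow_add[OF p, of "s - t" t] flow_add[OF p, of s t] by simp_all
  then show ?thesis
    unfolding flow_orbit_eq by blast
qed

text \<open>At a zero of \<open>X\<close> the isotropy group is the whole flow group. Principal
  orbits have the smallest isotropy, so every orbit contains a point fixed by the whole flow and
  consists of that point alone. This excludes zeros of \<open>X\<close> on the surface far from the
  patch.\<close>

lemma regular_zero_imp_zero:
  assumes p: "p \<in> regular_part N \<phi>" and zero: "X p = (\<lambda>_. 0)" and q: "q \<in> points N"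
  shows "X q = (\<lambda>_. 0)"
proof -
  have pN: "p \<in> points N"
    using p unfolding regular_part_def by blast
  obtain q' where q': "q' \<in> flow_orbit N \<phi> q"
    and stab: "flow_stabilizer N \<phi> p \<subseteq> flow_stabilizer N \<phi> q'"
    using p q unfolding regular_part_def by blast
  have "\<phi> t \<in> flow_stabilizer N \<phi> p" for t
    using flow_fixes_zero[OF pN zero] by (simp add: stabilizer_def flow_group_def)
  then have fix': "\<phi> t q' = q'" for t
    using stab by (auto simp: stabilizer_def)
  obtain r where r: "q' = \<phi> r q"
    using q' unfolding flow_orbit_eq by blast
  have "q = \<phi> (- r) q'"
    using flow_add[OF q, of "- r" r] flow_0[OF q] r by simp
  then have "\<phi> t q = q" for t
    using fix' by simp
  then show ?thesis
    using flow_velocity[OF q, of 0] by (simp add: velocity_const)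
qed

lemma continuous_field_along_curve:
  assumes c: "diff_at euclidean_mfd N c t" and \<kappa>: "\<kappa> \<in> charts_at N (c t)"
  shows "isCont (\<lambda>s. X (c s) \<kappa>) t"
proof -
  note k = charts_atD[OF charted \<kappa>]
  have "smooth_on (snd \<kappa> ` fst \<kappa>) (\<lambda>y. X (chart_inv \<kappa> y) \<kappa>)"
    using killing k(2) unfolding killing_field_flow_def smooth_vector_field_def by blast
  moreover have "open (snd \<kappa> ` fst \<kappa>)"
    using k(1) unfolding is_chart_def by blast
  ultimately have "isCont (\<lambda>y. X (chart_inv \<kappa> y) \<kappa>) ((snd \<kappa> \<circ> c) t)"
    using smooth_on_continuous_on continuous_on_eq_continuous_at k(3) by fastforce
  then have "isCont ((\<lambda>y. X (chart_inv \<kappa> y) \<kappa>) \<circ> (snd \<kappa> \<circ> c)) t"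
    by (rule continuous_within_compose[OF continuous_chart_along_curve[OF c \<kappa>] continuous_at_imp_continuous_within])
  moreover have "\<forall>\<^sub>F s in nhds t. ((\<lambda>y. X (chart_inv \<kappa> y) \<kappa>) \<circ> (snd \<kappa> \<circ> c)) s = X (c s) \<kappa>"
    using eventually_charts_at_along_curve[OF c \<kappa>]
    by eventually_elim (simp add: charts_at_def chart_inv_left[OF k(1)])
  ultimately show ?thesis
    by (simp only: isCont_cong)
qed

end


section \<open>The Riemannian submersion onto the orbit space\<close>

locale killing_quotient = killing_flow N g X \<phi>
  for N :: "('a, 'd::euclidean_space) mfd" and g X \<phi> +
  fixes B :: "('a set, 'e::euclidean_space) mfd" and gB :: "('a set, 'e) metric_field"
  assumes quotient: "riemannian_quotient N g \<phi> B gB" and dim: "DIM('d) = Suc (DIM('e))"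
begin

abbreviation (input) "\<pi> \<equiv> flow_orbit N \<phi>"

lemma base_smooth: "smooth_manifold B"
  using quotient unfolding riemannian_quotient_def riemannian_manifold_def by blast

lemma regular_points: "p \<in> regular_part N \<phi> \<Longrightarrow> p \<in> points N"
  unfolding regular_part_def by blast

lemma quotient_diff_at: "p \<in> regular_part N \<phi> \<Longrightarrow> diff_at N B \<pi> p"
  by (rule smooth_map_on_diff_at)
    (use quotient in \<open>simp_all add: riemannian_quotient_def riemannian_submersion_on_def\<close>)

text \<open>The orbit map is constant along integral curves, which have velocity \<open>X p\<close>
  at time 0.\<close>

lemma quotient_field:
  assumes p: "p \<in> regular_part N \<phi>"
  shows "differential N B \<pi> p (X p) = (\<lambda>_. 0)"
proof -
  have pN: "p \<in> points N"
    by (rule regular_points[OF p])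
  have "differential N B \<pi> p (X p) = velocity B (\<pi> \<circ> (\<lambda>s. \<phi> s p)) 0"
    using velocity_compose[OF charted flow_curve_diff_at[OF pN], of B \<pi> 0] quotient_diff_at[OF p]
      flow_velocity[OF pN, of 0] by (simp add: flow_0[OF pN])
  also have "\<pi> \<circ> (\<lambda>s. \<phi> s p) = (\<lambda>_. \<pi> p)"
    using flow_orbit_flow[OF pN] by auto
  finally show ?thesis
    by (simp add: velocity_const)
qed

text \<open>The differential of a submersion is onto, so with the dimension dropping by one its
  kernel is a line; the nonzero vector \<open>X p\<close> lies in it.\<close>

lemma quotient_kernel:
  assumes p: "p \<in> regular_part N \<phi>" and Xp: "X p \<noteq> (\<lambda>_. 0)"
    and w: "w \<in> tangent_space N p" "differential N B \<pi> p w = (\<lambda>_. 0)"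
  obtains a where "w = (\<lambda>\<kappa>. a *\<^sub>R X p \<kappa>)"
proof -
  have pN: "p \<in> points N"
    by (rule regular_points[OF p])
  define \<kappa> where "\<kappa> = (SOME \<kappa>. \<kappa> \<in> charts_at N p)"
  have \<kappa>: "\<kappa> \<in> charts_at N p"
    using some_chart_at[OF charted pN] unfolding \<kappa>_def .
  obtain \<mu> where \<mu>: "\<mu> \<in> charts_at B (\<pi> p)"
    using charts_at_nonempty[OF smooth_manifold_imp_charted[OF base_smooth]
        diff_at_points(2)[OF quotient_diff_at[OF p]]] .
  define D where "D = frechet_derivative (snd \<mu> \<circ> \<pi> \<circ> chart_inv \<kappa>) (at (snd \<kappa> p))"
  have D: "differential N B \<pi> p v \<mu> = D (v \<kappa>)" for v
    using \<mu> by (simp add: differential_def Let_def \<kappa>_def[symmetric] D_def)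
  have onto: "differential N B \<pi> p ` tangent_space N p = tangent_space B (\<pi> p)"
    using quotient p by (simp add: riemannian_quotient_def riemannian_submersion_on_def)
  \<comment> \<open>Every coordinate value is realized by some \<open>coord_vec\<close>, so
    surjectivity onto the tangent space becomes surjectivity of the coordinate derivative.\<close>
  have "surj D"
    unfolding surj_def
  proof
    fix e
    have "coord_vec B \<mu> (\<pi> p) e \<in> differential N B \<pi> p ` tangent_space N p"
      unfolding onto by (rule coord_vec_in_tangent_space[OF base_smooth \<mu>])
    then obtain v where "coord_vec B \<mu> (\<pi> p) e = differential N B \<pi> p v"
      by blast
    then have "e = D (v \<kappa>)"
      using coord_vec_self[OF base_smooth \<mu>, of e] D[of v] by simp
    then show "\<exists>x. e = D x" ..
  qed
  moreover have "linear D"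
    using has_derivative_linear[OF diff_atD_deriv[OF quotient_diff_at[OF p] \<kappa> \<mu>]] by (simp add: D_def)
  moreover have "X p \<kappa> \<noteq> 0"
    using tangent_vec_eqI[OF field_tangent[OF pN] tangent_space_zero[OF smooth] \<kappa>] Xp by auto
  moreover have "D (X p \<kappa>) = 0" "D (w \<kappa>) = 0"
    using D[of "X p"] D[of w] quotient_field[OF p] w(2) by simp_all
  ultimately obtain a where a: "w \<kappa> = a *\<^sub>R X p \<kappa>"
    using linear_surj_kernel_line[of D "X p \<kappa>" "w \<kappa>"] dim by blast
  have "(\<lambda>\<kappa>. a *\<^sub>R X p \<kappa>) \<in> tangent_space N p"
    using tangent_space_lincomb[OF smooth field_tangent[OF pN] field_tangent[OF pN], of a 0] by simp
  then have "w = (\<lambda>\<kappa>. a *\<^sub>R X p \<kappa>)"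
    using a by (intro tangent_vec_eqI[OF w(1) _ \<kappa>]) simp_all
  then show thesis
    by (rule that)
qed

text \<open>Projecting \<open>v\<close> orthogonally to the Killing field does not change its image in the quotient.\<close>

lemma quotient_metric:
  assumes p: "p \<in> regular_part N \<phi>" and Xp: "X p \<noteq> (\<lambda>_. 0)" and v: "v \<in> tangent_space N p"
  shows "gB (\<pi> p) (differential N B \<pi> p v) (differential N B \<pi> p v) =
    g p v v - (g p v (X p))\<^sup>2 / g p (X p) (X p)"
proof -
  have pN: "p \<in> points N"
    by (rule regular_points[OF p])
  note X = field_tangent[OF pN]
  note d = quotient_diff_at[OF p]
  define a where "a = - (g p v (X p) / g p (X p) (X p))"
  define h where "h = (\<lambda>\<kappa>. 1 *\<^sub>R v \<kappa> + a *\<^sub>R X p \<kappa>)"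
  have pos: "0 < g p (X p) (X p)"
    by (rule metric_pos[OF pN X Xp])
  have h: "h \<in> tangent_space N p"
    unfolding h_def by (rule tangent_space_lincomb[OF smooth v X])
  have hX: "g p h (X p) = 0"
    using metric_lincomb_left[OF pN v X X, of 1 a] pos by (simp add: h_def a_def)
  \<comment> \<open>Orthogonality to \<open>X p\<close> alone suffices, because the kernel consists
    of multiples of \<open>X p\<close>.\<close>
  have hor: "h \<in> horizontal_space N g B \<pi> p"
    unfolding horizontal_space_def
  proof (intro CollectI conjI h ballI impI)
    fix w assume "w \<in> tangent_space N p" "differential N B \<pi> p w = (\<lambda>_. 0)"
    then obtain b where "w = (\<lambda>\<kappa>. b *\<^sub>R X p \<kappa>)"
      using quotient_kernel[OF p Xp] by blast
    then show "g p h w = 0"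
      using metric_lincomb_right[OF pN X X h, of b 0] hX by simp
  qed
  have "differential N B \<pi> p h = differential N B \<pi> p v"
    using differential_lincomb[OF charted d, of 1 v a "X p"] quotient_field[OF p] by (simp add: h_def)
  then have "gB (\<pi> p) (differential N B \<pi> p v) (differential N B \<pi> p v) =
      gB (\<pi> p) (differential N B \<pi> p h) (differential N B \<pi> p h)"
    by simp
  also have "\<dots> = g p h h"
    using quotient p hor by (simp add: riemannian_quotient_def riemannian_submersion_on_def)
  also have "\<dots> = g p v v + 2 * a * g p v (X p) + a\<^sup>2 * g p (X p) (X p)"
    using metric_quadratic[OF pN v X, of 1 a] by (simp add: h_def)
  also have "\<dots> = g p v v - (g p v (X p))\<^sup>2 / g p (X p) (X p)"
    using pos by (simp add: a_def power2_eq_square field_simps)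
  finally show ?thesis .
qed

end


section \<open>Real functions with derivative of constant modulus\<close>

text \<open>Continuity of \<open>h'\<close> is not assumed, so the sign cannot be fixed by an
  intermediate value argument for \<open>h'\<close>. Instead the mean value theorem makes
  \<open>h\<close> injective, a continuous injective function on an interval is strictly monotone,
  and monotonicity decides the sign.\<close>

lemma derivative_constant_modulus:
  fixes h :: "real \<Rightarrow> real"
  assumes S: "open S" "is_interval S" and h: "\<And>s. s \<in> S \<Longrightarrow> (h has_real_derivative h' s) (at s)"
    and sq: "\<And>s. s \<in> S \<Longrightarrow> (h' s)\<^sup>2 = m\<^sup>2" and m: "0 < m"
  obtains \<sigma> where "\<sigma> \<in> {1, -1}" "\<And>s. s \<in> S \<Longrightarrow> h' s = \<sigma> * m"
proof -
  have cont: "continuous_on T h" if "T \<subseteq> S" for T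
    using that h by (meson DERIV_continuous continuous_at_imp_continuous_on subsetD)
  have nz: "h' s \<noteq> 0" if "s \<in> S" for s
    using sq[OF that] m by auto
  have ne: "h a \<noteq> h b" if ab: "a \<in> S" "b \<in> S" "a < b" for a b
  proof -
    have S': "x \<in> S" if "a \<le> x" "x \<le> b" for x
      using mem_is_interval_1_I[OF S(2) ab(1,2) that] .
    then obtain z where z: "a < z" "z < b" "h b - h a = (b - a) * h' z"
      using MVT2[OF ab(3), of h h'] h by blast
    then have "h' z \<noteq> 0"
      using nz S' by simp
    then show ?thesis
      using z by auto
  qed
  have "inj_on h S"
    by (rule linorder_inj_onI') (use ne in blast)
  then have "strict_mono_on S h \<or> strict_antimono_on S h"
    using injective_eq_monotone_map[OF S(2) cont] by blast
  then show thesis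
  proof
    assume mono: "strict_mono_on S h"
    have "h' s = 1 * m" if "s \<in> S" for s
    proof -
      have "0 \<le> h' s"
        using mono_on_imp_deriv_nonneg[OF strict_mono_on_imp_mono_on[OF mono] h[OF that]] that S(1)
        by (simp add: interior_open)
      then show ?thesis
        using sq[OF that] m by (simp add: power2_eq_iff_nonneg)
    qed
    then show thesis
      using that[of 1] by blast
  next
    assume anti: "strict_antimono_on S h"
    have "h' s = - 1 * m" if "s \<in> S" for s
    proof -
      have "mono_on S (\<lambda>x. - h x)"
        using anti by (auto simp: monotone_on_def less_le)
      then have "0 \<le> - h' s"
        using mono_on_imp_deriv_nonneg[of S "\<lambda>x. - h x" "- h' s" s] DERIV_minus[OF h[OF that]] that S(1)
        by (simp add: interior_open)
      then have "- h' s = m"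
        using sq[OF that] m power2_eq_iff_nonneg[of "- h' s" m] by simp
      then show ?thesis
        by simp
    qed
    then show thesis
      using that[of "- 1"] by blast
  qed
qed

lemma affine_if_derivative_constant:
  fixes h :: "real \<Rightarrow> real"
  assumes S: "open S" "is_interval S" and h: "\<And>s. s \<in> S \<Longrightarrow> (h has_real_derivative a) (at s)"
    and s: "s\<^sub>0 \<in> S" "s \<in> S"
  shows "h s = h s\<^sub>0 + a * (s - s\<^sub>0)"
proof -
  have "((\<lambda>s. h s - a * s) has_real_derivative 0) (at r within S)" if "r \<in> S" for r
    using DERIV_subset[OF h[OF that]] by (auto intro!: derivative_eq_intros)
  then obtain C where "\<And>r. r \<in> S \<Longrightarrow> h r - a * r = C"
    using has_field_derivative_zero_constant[of S "\<lambda>s. h s - a * s"] S(2) is_interval_convex by blast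
  from this[OF s(1)] this[OF s(2)] show ?thesis
    by (simp add: algebra_simps)
qed

text \<open>The antiderivative of \<open>q\<close> is \<open>k\<close> after the inverse affine
  substitution. Since \<open>a\<close> may be negative, the integral may run backwards; the bounds
  with \<open>min\<close> and \<open>max\<close> treat both directions at once.\<close>

lemma integral_along_affine:
  fixes k q :: "real \<Rightarrow> real"
  assumes S: "is_interval S" and k: "\<And>s. s \<in> S \<Longrightarrow> (k has_real_derivative a * q (u\<^sub>0 + a * (s - s\<^sub>0))) (at s)"
    and q: "\<And>s. s \<in> S \<Longrightarrow> isCont q (u\<^sub>0 + a * (s - s\<^sub>0))"
    and a: "a \<noteq> 0" and s: "s\<^sub>0 \<in> S" "s \<in> S"
  shows "(LBINT t=ereal u\<^sub>0..ereal (u\<^sub>0 + a * (s - s\<^sub>0)). q t) = k s - k s\<^sub>0"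
proof -
  define u where "u = u\<^sub>0 + a * (s - s\<^sub>0)"
  define r where "r t = s\<^sub>0 + (t - u\<^sub>0) / a" for t
  \<comment> \<open>A point between \<open>u\<^sub>0\<close> and \<open>u\<close> comes, with the
    same convex coefficient, from a point between \<open>s\<^sub>0\<close> and \<open>s\<close>, and
    the interval \<open>S\<close> contains that one.\<close>
  have r: "r t \<in> S" "u\<^sub>0 + a * (r t - s\<^sub>0) = t" if "t \<in> {min u\<^sub>0 u..max u\<^sub>0 u}" for t
  proof -
    have "t \<in> closed_segment u\<^sub>0 u"
      using that by (auto simp: closed_segment_eq_real_ivl min_def max_def split: if_splits)
    then obtain l where l: "0 \<le> l" "l \<le> 1" "t = (1 - l) *\<^sub>R u\<^sub>0 + l *\<^sub>R u"
      unfolding in_segment by blast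
    have "t - u\<^sub>0 = (l * (s - s\<^sub>0)) * a"
      by (simp add: l(3) u_def algebra_simps)
    then have "(t - u\<^sub>0) / a = l * (s - s\<^sub>0)"
      using a by simp
    then have "r t = (1 - l) *\<^sub>R s\<^sub>0 + l *\<^sub>R s"
      by (simp add: r_def algebra_simps)
    then show "r t \<in> S"
      using convexD_alt[OF S[unfolded is_interval_convex_1] s l(1,2)] by simp
    show "u\<^sub>0 + a * (r t - s\<^sub>0) = t"
      using a by (simp add: r_def)
  qed
  have "(LBINT t=ereal u\<^sub>0..ereal u. q t) = k (r u) - k (r u\<^sub>0)"
  proof (rule interval_integral_FTC_finite)
    show "continuous_on {min u\<^sub>0 u..max u\<^sub>0 u} q"
    proof (rule continuous_at_imp_continuous_on, rule ballI)
      fix t assume "t \<in> {min u\<^sub>0 u..max u\<^sub>0 u}"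
      then show "isCont q t"
        using q[OF r(1)] r(2) by simp
    qed
    show "((\<lambda>t. k (r t)) has_vector_derivative q t) (at t within {min u\<^sub>0 u..max u\<^sub>0 u})"
      if "min u\<^sub>0 u \<le> t" "t \<le> max u\<^sub>0 u" for t
    proof -
      have t: "r t \<in> S" "u\<^sub>0 + a * (r t - s\<^sub>0) = t"
        using r that by auto
      have "(r has_real_derivative 1 / a) (at t)"
        unfolding r_def using a by (auto intro!: derivative_eq_intros)
      from DERIV_chain2[OF k[OF t(1)] this] have "((\<lambda>t. k (r t)) has_real_derivative q t) (at t)"
        using a t(2) by simp
      then show ?thesis
        by (simp add: has_real_derivative_iff_has_vector_derivative has_vector_derivative_at_within)
    qed
  qed
  then show ?thesis
    using a by (simp add: r_def u_def)
qed

lemma smooth_on_affine: "smooth_on S (\<lambda>s::real. b + a * (s - d))"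
proof -
  \<comment> \<open>The constant must be generalized in the induction, as the derivative of a
    constant is another constant, namely 0.\<close>
  have const: "C_k_on k S (\<lambda>_. e)" for k and e :: real
    by (induction k arbitrary: e) simp_all
  have der: "((\<lambda>s. b + a * (s - d)) has_derivative (\<lambda>e. a * e)) (at x)" for x
    by (auto intro!: derivative_eq_intros)
  have "C_k_on k S (\<lambda>s. b + a * (s - d))" for k
  proof (cases k)
    case 0
    then show ?thesis
      by (auto intro!: continuous_intros)
  next
    case (Suc j)
    have "frechet_derivative (\<lambda>s. b + a * (s - d)) (at x) e = a * e" for x e
      using fun_cong[OF frechet_derivative_at[OF der]] by simp
    then show ?thesis
      using der const unfolding Suc by (auto simp: differentiable_def)
  qed
  then show ?thesis
    unfolding smooth_on_def by blast
qed

lemma affine_reparametrization: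
  assumes "0 < r" "a \<noteq> 0"
  shows "reparametrization (ball s\<^sub>0 r) ((\<lambda>s. u\<^sub>0 + a * (s - s\<^sub>0)) ` ball s\<^sub>0 r) (\<lambda>s. u\<^sub>0 + a * (s - s\<^sub>0))"
proof -
  have eq: "(\<lambda>s. u\<^sub>0 + a * (s - s\<^sub>0)) = (\<lambda>s. (u\<^sub>0 - a * s\<^sub>0) + a *\<^sub>R s)"
    by (auto simp: algebra_simps)
  have "open ((\<lambda>s. u\<^sub>0 + a * (s - s\<^sub>0)) ` ball s\<^sub>0 r)"
    unfolding eq using open_affinity[OF open_ball assms(2)] .
  moreover have "is_interval ((\<lambda>s. u\<^sub>0 + a * (s - s\<^sub>0)) ` ball s\<^sub>0 r)"
    unfolding is_interval_convex_1 eq by (rule convex_affinity[OF convex_ball])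
  moreover have "inj_on (\<lambda>s. u\<^sub>0 + a * (s - s\<^sub>0)) (ball s\<^sub>0 r)"
    using assms(2) by (auto simp: inj_on_def)
  moreover have "deriv (\<lambda>s. u\<^sub>0 + a * (s - s\<^sub>0)) s = a" for s
    by (rule DERIV_imp_deriv) (auto intro!: derivative_eq_intros)
  ultimately show ?thesis
    using assms(2) unfolding reparametrization_def bij_betw_def
    by (auto simp: smooth_on_affine is_interval_convex_1)
qed


section \<open>Curves with velocity proportional to the Killing field\<close>

context killing_quotient
begin

text \<open>The equality case of the Cauchy-Schwarz inequality: the difference of the two sides has
  squared length 0. It also covers \<open>X p = 0\<close>.\<close>

lemma unit_parallel_field:
  assumes p: "p \<in> points N" and v: "v \<in> tangent_space N p" and "g p v v = 1"
    and "g p v (X p) = vec_norm g p (X p)"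
  shows "X p = (\<lambda>\<kappa>. vec_norm g p (X p) *\<^sub>R v \<kappa>)"
proof -
  note X = field_tangent[OF p]
  define r where "r = vec_norm g p (X p)"
  define w where "w = (\<lambda>\<kappa>. 1 *\<^sub>R X p \<kappa> + (- r) *\<^sub>R v \<kappa>)"
  have "r\<^sup>2 = g p (X p) (X p)"
    using metric_nonneg[OF p X] by (simp add: r_def vec_norm_def)
  then have "g p w w = 0"
    using metric_quadratic[OF p X v, of 1 "- r"] metric_sym[OF p X v] assms(3,4)
    by (simp add: w_def r_def[symmetric] power2_eq_square)
  moreover have "w \<in> tangent_space N p"
    unfolding w_def by (rule tangent_space_lincomb[OF smooth X v])
  ultimately have "w = (\<lambda>_. 0)"
    using metric_pos[OF p, of w] by fastforce
  then show ?thesis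
    unfolding w_def r_def by (metis (no_types, lifting) add_eq_0_iff scaleR_minus_left scaleR_one minus_minus ext)
qed

text \<open>The curve has a constant image under \<pi>, and the value of \<pi> at a point is its
  orbit as a set. No flow time along the orbit has to be constructed.\<close>

lemma along_field_in_orbit:
  assumes J: "open J" "connected J"
    and y: "\<And>s. s \<in> J \<Longrightarrow> diff_at euclidean_mfd N y s" "\<And>s. s \<in> J \<Longrightarrow> y s \<in> regular_part N \<phi>"
    and vel: "\<And>s. s \<in> J \<Longrightarrow> velocity N y s = (\<lambda>\<kappa>. a s *\<^sub>R X (y s) \<kappa>)"
    and st: "s \<in> J" "t \<in> J"
  shows "y s \<in> flow_orbit N \<phi> (y t)"
proof -
  have "(\<pi> \<circ> y) s = (\<pi> \<circ> y) t"
  proof (rule velocity_zero_imp_constant[OF smooth_manifold_imp_charted[OF base_smooth] J _ _ st])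
    fix r assume r: "r \<in> J"
    note d = quotient_diff_at[OF y(2)[OF r]]
    show "diff_at euclidean_mfd B (\<pi> \<circ> y) r"
      by (rule diff_at_compose[OF charted_euclidean charted y(1)[OF r] d])
    have "velocity B (\<pi> \<circ> y) r = differential N B \<pi> (y r) (\<lambda>\<kappa>. a r *\<^sub>R X (y r) \<kappa>)"
      using velocity_compose[OF charted y(1)[OF r] d] vel[OF r] by simp
    also have "\<dots> = (\<lambda>_. 0)"
      using differential_lincomb[OF charted d, of "a r" "X (y r)" 0 "X (y r)"] quotient_field[OF y(2)[OF r]]
      by simp
    finally show "velocity B (\<pi> \<circ> y) r = (\<lambda>_. 0)" .
  qed
  then show ?thesis
    using flow_orbit_self[OF regular_points[OF y(2)[OF st(1)]]] by simp
qed

end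


section \<open>Invariant surfaces\<close>

locale invariant_patch = killing_quotient N g X \<phi> B gB
  for N :: "('a, 'd::euclidean_space) mfd" and g X \<phi>
    and B :: "('a set, 'e::euclidean_space) mfd" and gB +
  fixes M :: "('m, real^2) mfd" and f :: "'m \<Rightarrow> 'a" and \<rho> :: "('a \<Rightarrow> 'a) \<Rightarrow> 'm \<Rightarrow> 'm"
    and I :: "real set" and \<epsilon> :: real and \<gamma>t :: "real \<Rightarrow> 'a set" and \<gamma> :: "real \<Rightarrow> 'a"
    and \<Psi> :: "real \<times> real \<Rightarrow> 'm"
  assumes surface: "invariant_surface N \<phi> M f \<rho>"
    and patch: "invariant_parametrization N \<phi> B gB M f I \<epsilon> \<gamma>t \<gamma> \<Psi>"
begin

abbreviation "W \<equiv> I \<times> {-\<epsilon><..<\<epsilon>}"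

text \<open>This is the coefficient at parameter \<open>v = 0\<close>, with the partial derivatives
  already replaced by \<open>\<gamma>'\<close> and \<open>X\<close>. Agreement with
  \<open>coeff_F\<close> is established on \<open>I\<close> only.\<close>

definition F where "F u = g (\<gamma> u) (velocity N \<gamma> u) (X (\<gamma> u))"

definition \<omega> where "\<omega> u = vec_norm g (\<gamma> u) (X (\<gamma> u))"

section \<open>Regularity of the surface, its parametrization and the lift\<close>

lemma open_I: "open I"
  using patch unfolding invariant_parametrization_def by blast

lemma open_W: "open W"
  using open_I by (intro open_Times) auto

lemma eps_pos: "0 < \<epsilon>"
  using patch unfolding invariant_parametrization_def by blast

lemma surface_smooth: "smooth_manifold M"
  using surface unfolding invariant_surface_def by blast

lemma surface_charted: "charted M"
  by (rule smooth_manifold_imp_charted[OF surface_smooth])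

lemma immersion_diff_at: "x \<in> points M \<Longrightarrow> diff_at M N f x"
  by (rule smooth_map_on_diff_at) (use surface in \<open>simp_all add: invariant_surface_def\<close>)

lemma immersion_regular: "x \<in> points M \<Longrightarrow> f x \<in> regular_part N \<phi>"
  using surface unfolding invariant_surface_def by blast

lemma regular_param: "regular_parametrization M W \<Psi>"
  using patch unfolding invariant_parametrization_def by blast

lemma param_diff_at: "w \<in> W \<Longrightarrow> diff_at euclidean_mfd M \<Psi> w"
  by (rule smooth_map_on_diff_at)
    (use regular_param in \<open>simp_all add: regular_parametrization_def prod_mfd_euclidean\<close>)

lemma param_points: "w \<in> W \<Longrightarrow> \<Psi> w \<in> points M"
  by (rule diff_at_points(2)[OF param_diff_at])

lemma param_eq: "u \<in> I \<Longrightarrow> v \<in> {-\<epsilon><..<\<epsilon>} \<Longrightarrow> f (\<Psi> (u, v)) = \<phi> v (\<gamma> u)"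
  using patch unfolding invariant_parametrization_def flow_param_def by blast

lemma surface_param_diff_at: "w \<in> W \<Longrightarrow> diff_at euclidean_mfd N (f \<circ> \<Psi>) w"
  by (rule diff_at_compose[OF charted_euclidean surface_charted param_diff_at
        immersion_diff_at[OF param_points]])

lemma lift: "lift_of_curve (regular_part N \<phi>) N B \<pi> I \<gamma>t \<gamma>"
  using patch unfolding invariant_parametrization_def by blast

lemma profile: "profile_curve B gB I \<gamma>t"
  using patch unfolding invariant_parametrization_def by blast

lemma lift_smooth: "smooth_map_on I euclidean_mfd N \<gamma>"
  using lift unfolding lift_of_curve_def by blast

lemma lift_diff_at: "u \<in> I \<Longrightarrow> diff_at euclidean_mfd N \<gamma> u"
  by (rule smooth_map_on_diff_at[OF lift_smooth])

lemma lift_regular: "u \<in> I \<Longrightarrow> \<gamma> u \<in> regular_part N \<phi>"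
  using lift unfolding lift_of_curve_def by blast

lemma lift_points: "u \<in> I \<Longrightarrow> \<gamma> u \<in> points N"
  by (rule regular_points[OF lift_regular])

lemma lift_velocity_tangent: "u \<in> I \<Longrightarrow> velocity N \<gamma> u \<in> tangent_space N (\<gamma> u)"
  by (rule velocity_in_tangent_space[OF smooth lift_diff_at])

text \<open>\<open>f \<circ> \<Psi>\<close> is known to follow the flow only inside the patch, so
  velocities along coordinate lines are compared near the parameter.\<close>

lemma partial_derivative_v:
  assumes u: "u \<in> I" and v: "v \<in> {-\<epsilon><..<\<epsilon>}"
  shows "differential euclidean_mfd N (f \<circ> \<Psi>) (u, v) (euclidean_vec (0, 1)) = X (\<phi> v (\<gamma> u))"
proof -
  have hv: "((\<lambda>r. (u, r)) has_vector_derivative (0, 1)) (at v)"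
    by (auto intro!: derivative_eq_intros has_vector_derivative_Pair)
  have d: "diff_at euclidean_mfd euclidean_mfd (\<lambda>r. (u, r)) v"
    by (intro diff_at_euclidean differentiableI_vector[OF hv])
  have w: "diff_at euclidean_mfd N (f \<circ> \<Psi>) (u, v)"
    using u v by (intro surface_param_diff_at) simp
  have "differential euclidean_mfd N (f \<circ> \<Psi>) (u, v) (euclidean_vec (0, 1)) =
      velocity N ((f \<circ> \<Psi>) \<circ> (\<lambda>r. (u, r))) v"
    unfolding velocity_compose[OF charted_euclidean d w] velocity_euclidean vector_derivative_at[OF hv] ..
  also have "\<dots> = velocity N (\<lambda>r. \<phi> r (\<gamma> u)) v"
    using v by (intro velocity_cong eventually_mono[OF eventually_nhds_in_open[of "{-\<epsilon><..<\<epsilon>}"]])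
      (simp_all add: param_eq[OF u])
  also have "\<dots> = X (\<phi> v (\<gamma> u))"
    by (rule flow_velocity[OF lift_points[OF u]])
  finally show ?thesis .
qed

text \<open>The \<open>u\<close>-derivative at height \<open>v\<close> is the image of
  \<open>\<gamma>'\<close> under an isometry; this is why the induced metric does not depend on
  \<open>v\<close>.\<close>

lemma partial_derivative_u:
  assumes u: "u \<in> I" and v: "v \<in> {-\<epsilon><..<\<epsilon>}"
  shows "differential euclidean_mfd N (f \<circ> \<Psi>) (u, v) (euclidean_vec (1, 0)) =
    differential N N (\<phi> v) (\<gamma> u) (velocity N \<gamma> u)"
proof -
  have hv: "((\<lambda>r. (r, v)) has_vector_derivative (1, 0)) (at u)"
    by (auto intro!: derivative_eq_intros has_vector_derivative_Pair)
  have d: "diff_at euclidean_mfd euclidean_mfd (\<lambda>r. (r, v)) u"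
    by (intro diff_at_euclidean differentiableI_vector[OF hv])
  have w: "diff_at euclidean_mfd N (f \<circ> \<Psi>) (u, v)"
    using u v by (intro surface_param_diff_at) simp
  have "differential euclidean_mfd N (f \<circ> \<Psi>) (u, v) (euclidean_vec (1, 0)) =
      velocity N ((f \<circ> \<Psi>) \<circ> (\<lambda>r. (r, v))) u"
    unfolding velocity_compose[OF charted_euclidean d w] velocity_euclidean vector_derivative_at[OF hv] ..
  also have "\<dots> = velocity N (\<phi> v \<circ> \<gamma>) u"
    using v by (intro velocity_cong eventually_mono[OF eventually_nhds_in_open[OF open_I u]])
      (simp add: param_eq)
  also have "\<dots> = differential N N (\<phi> v) (\<gamma> u) (velocity N \<gamma> u)"
    by (rule velocity_compose[OF charted lift_diff_at[OF u] flow_diff_at[OF lift_points[OF u]]])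
  finally show ?thesis .
qed

text \<open>The differentials of \<open>\<Psi>\<close> and \<open>f\<close> are injective, and their
  composition maps the coordinate vector \<open>(0, 1)\<close> to \<open>X\<close>.\<close>

lemma field_nonzero_lift:
  assumes u: "u \<in> I" shows "X (\<gamma> u) \<noteq> (\<lambda>_. 0)"
proof
  assume zero: "X (\<gamma> u) = (\<lambda>_. 0)"
  have w: "(u, 0) \<in> W"
    using u eps_pos by simp
  have dP: "diff_at euclidean_mfd M \<Psi> (u, 0)" and df: "diff_at M N f (\<Psi> (u, 0))"
    by (rule param_diff_at[OF w], rule immersion_diff_at[OF param_points[OF w]])
  define e where "e = differential euclidean_mfd M \<Psi> (u, 0) (euclidean_vec (0, 1))"
  have e: "e \<in> tangent_space M (\<Psi> (u, 0))"
    unfolding e_def by (rule differential_in_tangent_space[OF charted_euclidean surface_smooth dP])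
  have "differential M N f (\<Psi> (u, 0)) e = X (\<phi> 0 (\<gamma> u))"
    using differential_compose[OF charted_euclidean surface_charted dP df]
      partial_derivative_v[OF u, of 0] eps_pos by (simp add: e_def)
  then have "differential M N f (\<Psi> (u, 0)) e = differential M N f (\<Psi> (u, 0)) (\<lambda>_. 0)"
    using zero differential_zero[OF surface_charted df] flow_0[OF lift_points[OF u]] by simp
  moreover have "inj_on (differential M N f (\<Psi> (u, 0))) (tangent_space M (\<Psi> (u, 0)))"
    using surface param_points[OF w] unfolding invariant_surface_def by blast
  ultimately have "e = (\<lambda>_. 0)"
    using inj_onD e tangent_space_zero[OF surface_smooth] by metis
  also have "\<dots> = differential euclidean_mfd M \<Psi> (u, 0) (euclidean_vec 0)"
    using differential_zero[OF charted_euclidean dP] by (simp add: euclidean_vec_def)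
  finally have eq: "differential euclidean_mfd M \<Psi> (u, 0) (euclidean_vec (0, 1)) =
      differential euclidean_mfd M \<Psi> (u, 0) (euclidean_vec 0)"
    unfolding e_def .
  have inj: "inj_on (differential euclidean_mfd M \<Psi> (u, 0)) (tangent_space euclidean_mfd (u, 0))"
    using regular_param w unfolding regular_parametrization_def prod_mfd_euclidean by blast
  have "euclidean_vec (0, 1) = (euclidean_vec 0 :: (real \<times> real, real \<times> real) tvec)"
    by (rule inj_onD[OF inj eq euclidean_vec_in_tangent_space euclidean_vec_in_tangent_space])
  from fun_cong[OF this, of "(UNIV, id)"] show False
    by (simp add: euclidean_vec_def zero_prod_def)
qed

lemma omega_pos: assumes u: "u \<in> I" shows "0 < \<omega> u"
  using metric_pos[OF lift_points[OF u] field_tangent[OF lift_points[OF u]] field_nonzero_lift[OF u]]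
  by (simp add: \<omega>_def vec_norm_def)

lemma omega_sq: assumes u: "u \<in> I" shows "(\<omega> u)\<^sup>2 = g (\<gamma> u) (X (\<gamma> u)) (X (\<gamma> u))"
  using metric_nonneg[OF lift_points[OF u] field_tangent[OF lift_points[OF u]]]
  by (simp add: \<omega>_def vec_norm_def)

text \<open>Here \<open>x\<close> may lie outside the patch: a zero of \<open>X\<close> at the
  regular point \<open>f x\<close> would make \<open>X\<close> vanish at \<open>\<gamma> u\<close>
  as well.\<close>

lemma field_nonzero_surface:
  assumes "x \<in> points M" "u \<in> I" shows "X (f x) \<noteq> (\<lambda>_. 0)"
  using regular_zero_imp_zero[OF immersion_regular[OF assms(1)] _ lift_points[OF assms(2)]]
    field_nonzero_lift[OF assms(2)] by blast

section \<open>The coefficients of the induced metric\<close>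

lemma coeff_F_eq:
  assumes u: "u \<in> I" shows "coeff_F N g (flow_param \<phi> \<gamma>) u 0 = F u"
proof -
  have "velocity N (\<lambda>r. flow_param \<phi> \<gamma> r 0) u = velocity N \<gamma> u"
    by (intro velocity_cong eventually_mono[OF eventually_nhds_in_open[OF open_I u]])
      (simp add: flow_param_def flow_0 lift_points)
  moreover have "velocity N (\<lambda>r. flow_param \<phi> \<gamma> u r) 0 = X (\<gamma> u)"
    using flow_velocity[OF lift_points[OF u], of 0] flow_0[OF lift_points[OF u]]
    by (simp add: flow_param_def)
  ultimately show ?thesis
    using flow_0[OF lift_points[OF u]] by (simp add: coeff_F_def F_def flow_param_def)
qed

text \<open>The lift need not be horizontal. The term
  \<open>(F u)\<^sup>2 / (\<omega> u)\<^sup>2\<close> is the squared length of its component along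
  \<open>X\<close>; the horizontal remainder has the length of the unit profile velocity.\<close>

lemma coeff_E_eq:
  assumes u: "u \<in> I"
  shows "g (\<gamma> u) (velocity N \<gamma> u) (velocity N \<gamma> u) = 1 + (F u)\<^sup>2 / (\<omega> u)\<^sup>2"
proof -
  have "sqrt (gB (\<gamma>t u) (velocity B \<gamma>t u) (velocity B \<gamma>t u)) = 1"
    using profile u unfolding profile_curve_def vec_norm_def by blast
  moreover have "\<pi> (\<gamma> u) = \<gamma>t u" "differential N B \<pi> (\<gamma> u) (velocity N \<gamma> u) = velocity B \<gamma>t u"
    using lift u unfolding lift_of_curve_def by blast+
  ultimately show ?thesis
    using quotient_metric[OF lift_regular[OF u] field_nonzero_lift[OF u] lift_velocity_tangent[OF u]]
    by (simp add: F_def omega_sq[OF u])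
qed

lemma continuous_lift_velocity:
  assumes u: "u \<in> I" and \<kappa>: "\<kappa> \<in> charts_at N (\<gamma> u)"
  shows "isCont (\<lambda>s. velocity N \<gamma> s \<kappa>) u"
proof -
  note k = charts_atD[OF charted \<kappa>]
  define S where "S = {x \<in> I. \<gamma> x \<in> fst \<kappa>}"
  have "openin (mtop euclidean_mfd) S"
    unfolding S_def using smooth_map_on_vimage[OF lift_smooth] k(1) unfolding is_chart_def by blast
  then have S: "open S" "u \<in> S"
    using u k(3) by (simp_all add: S_def)
  \<comment> \<open>The left side is the coordinate domain that \<open>smooth_map_on\<close>
    produces for the identity chart.\<close>
  have "id ` (UNIV \<inter> I \<inter> \<gamma> -` fst \<kappa>) = S"
    by (auto simp: S_def)
  then have sm: "smooth_on S (snd \<kappa> \<circ> \<gamma>)"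
    using lift_smooth k(2) unfolding smooth_map_on_def by (fastforce simp: euclidean_mfd_def inv_id)
  have "isCont (\<lambda>s. frechet_derivative (snd \<kappa> \<circ> \<gamma>) (at s) 1) u"
    using smooth_on_continuous_derivative[OF sm] S continuous_on_eq_continuous_at by blast
  moreover have "\<forall>\<^sub>F s in nhds u. frechet_derivative (snd \<kappa> \<circ> \<gamma>) (at s) 1 = velocity N \<gamma> s \<kappa>"
    using eventually_nhds_in_open[OF S]
  proof eventually_elim
    case (elim s)
    then have "\<kappa> \<in> charts_at N (\<gamma> s)"
      using k(2) by (simp add: S_def charts_at_def)
    then show ?case
      using frechet_derivative_eq_vector_derivative[OF smooth_on_differentiable[OF sm elim]]
      by (simp add: velocity_def)
  qed
  ultimately show ?thesis
    by (simp only: isCont_cong)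
qed

lemma continuous_F:
  assumes u: "u \<in> I" shows "isCont F u"
proof -
  obtain \<kappa> where \<kappa>: "\<kappa> \<in> charts_at N (\<gamma> u)"
    using charts_at_nonempty[OF charted lift_points[OF u]] .
  have "\<forall>\<^sub>F s in nhds u. velocity N \<gamma> s \<in> tangent_space N (\<gamma> s) \<and> X (\<gamma> s) \<in> tangent_space N (\<gamma> s)"
    by (intro eventually_mono[OF eventually_nhds_in_open[OF open_I u]])
      (simp add: lift_velocity_tangent field_tangent lift_points)
  then show ?thesis
    unfolding F_def
    by (rule continuous_metric_along_curve[OF lift_diff_at[OF u] \<kappa>])
      (rule continuous_lift_velocity[OF u \<kappa>] continuous_field_along_curve[OF lift_diff_at[OF u] \<kappa>])+
qed

lemma continuous_omega:
  assumes u: "u \<in> I" shows "isCont \<omega> u"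
proof -
  obtain \<kappa> where \<kappa>: "\<kappa> \<in> charts_at N (\<gamma> u)"
    using charts_at_nonempty[OF charted lift_points[OF u]] .
  note X = continuous_field_along_curve[OF lift_diff_at[OF u] \<kappa>]
  have "\<forall>\<^sub>F s in nhds u. X (\<gamma> s) \<in> tangent_space N (\<gamma> s) \<and> X (\<gamma> s) \<in> tangent_space N (\<gamma> s)"
    by (intro eventually_mono[OF eventually_nhds_in_open[OF open_I u]])
      (simp add: field_tangent lift_points)
  then have "isCont (\<lambda>s. g (\<gamma> s) (X (\<gamma> s)) (X (\<gamma> s))) u"
    by (rule continuous_metric_along_curve[OF lift_diff_at[OF u] \<kappa>]) (rule X)+
  then show ?thesis
    unfolding \<omega>_def vec_norm_def by (intro continuous_intros)
qed

text \<open>The velocity is \<open>a\<close> times the transported \<open>\<gamma>'\<close> plus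
  \<open>b\<close> times \<open>X\<close>, and the isometry \<open>\<phi> (k s)\<close> lets all
  inner products be evaluated at \<open>\<gamma> (h s)\<close>. The angle condition is linear and
  gives \<open>b\<close>; unit speed then gives the square of \<open>a\<close>.\<close>

lemma loxodrome_equations:
  assumes S: "open S" "s \<in> S" and c: "\<And>r. r \<in> S \<Longrightarrow> c r = \<Psi> (h r, k r)" and hk: "(h s, k s) \<in> W"
    and h: "(h has_real_derivative a) (at s)" and k: "(k has_real_derivative b) (at s)"
    and unit: "vec_norm g (f (c s)) (velocity N (f \<circ> c) s) = 1"
    and angle: "g (f (c s)) (velocity N (f \<circ> c) s) (X (f (c s))) =
      vec_norm g (f (c s)) (X (f (c s))) * cos \<theta>"
  shows "a\<^sup>2 = (sin \<theta>)\<^sup>2" and "b = (\<omega> (h s) * cos \<theta> - a * F (h s)) / (\<omega> (h s))\<^sup>2"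
proof -
  have u: "h s \<in> I" and v: "k s \<in> {-\<epsilon><..<\<epsilon>}"
    using hk by auto
  note pN = lift_points[OF u]
  define p where "p = \<gamma> (h s)"
  define q where "q = \<phi> (k s) p"
  define A where "A = differential N N (\<phi> (k s)) p (velocity N \<gamma> (h s))"
  have q: "f (c s) = q"
    using c[OF S(2)] param_eq[OF u v] by (simp add: q_def p_def)
  have qN: "q \<in> points N"
    using flow_points[OF pN] by (simp add: q_def p_def)
  have Xq: "X q = differential N N (\<phi> (k s)) p (X p)"
    using flow_field[OF pN] by (simp add: q_def p_def)
  have A: "A \<in> tangent_space N q"
    unfolding A_def q_def p_def by (rule differential_in_tangent_space[OF charted smooth flow_diff_at[OF pN]])
  note XT = field_tangent[OF qN]
  have iso: "g q A A = 1 + (F (h s))\<^sup>2 / (\<omega> (h s))\<^sup>2" "g q A (X q) = F (h s)"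
    "g q (X q) (X q) = (\<omega> (h s))\<^sup>2"
    using flow_isometry[OF pN] lift_velocity_tangent[OF u] field_tangent[OF pN] coeff_E_eq[OF u] omega_sq[OF u]
    unfolding Xq unfolding A_def q_def p_def by (simp_all add: F_def)
  have hk': "((\<lambda>r. (h r, k r)) has_vector_derivative (a, b)) (at s)"
    using h k by (intro has_vector_derivative_Pair) (simp_all add: has_real_derivative_iff_has_vector_derivative)
  have d: "diff_at euclidean_mfd euclidean_mfd (\<lambda>r. (h r, k r)) s"
    by (intro diff_at_euclidean differentiableI_vector[OF hk'])
  have w: "diff_at euclidean_mfd N (f \<circ> \<Psi>) (h s, k s)"
    by (rule surface_param_diff_at[OF hk])
  have "velocity N (f \<circ> c) s = velocity N ((f \<circ> \<Psi>) \<circ> (\<lambda>r. (h r, k r))) s"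
    by (intro velocity_cong eventually_mono[OF eventually_nhds_in_open[OF S]]) (simp add: c)
  also have "\<dots> = differential euclidean_mfd N (f \<circ> \<Psi>) (h s, k s) (euclidean_vec (a, b))"
    unfolding velocity_compose[OF charted_euclidean d w] velocity_euclidean vector_derivative_at[OF hk'] ..
  also have "euclidean_vec (a, b) = (\<lambda>\<kappa>. a *\<^sub>R euclidean_vec (1, 0) \<kappa> + b *\<^sub>R euclidean_vec (0, 1) \<kappa>)"
    by (auto simp: euclidean_vec_def)
  also have "differential euclidean_mfd N (f \<circ> \<Psi>) (h s, k s) \<dots> = (\<lambda>\<kappa>. a *\<^sub>R A \<kappa> + b *\<^sub>R X q \<kappa>)"
    unfolding differential_lincomb[OF charted_euclidean w] partial_derivative_u[OF u v]
      partial_derivative_v[OF u v] A_def q_def p_def ..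
  finally have vel: "velocity N (f \<circ> c) s = (\<lambda>\<kappa>. a *\<^sub>R A \<kappa> + b *\<^sub>R X q \<kappa>)" .
  have "vec_norm g q (X q) = \<omega> (h s)"
    using iso(3) omega_pos[OF u] by (simp add: vec_norm_def)
  then have eq1: "a * F (h s) + b * (\<omega> (h s))\<^sup>2 = \<omega> (h s) * cos \<theta>"
    using angle metric_lincomb_left[OF qN A XT XT, of a b] by (simp add: q vel iso)
  have eq2: "a\<^sup>2 * (1 + (F (h s))\<^sup>2 / (\<omega> (h s))\<^sup>2) + 2 * a * b * F (h s) + b\<^sup>2 * (\<omega> (h s))\<^sup>2 = 1"
    using unit metric_quadratic[OF qN A XT, of a b] by (simp add: q vel iso vec_norm_def)
  show b: "b = (\<omega> (h s) * cos \<theta> - a * F (h s)) / (\<omega> (h s))\<^sup>2"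
    using eq1 omega_pos[OF u] by (simp add: field_simps)
  \<comment> \<open>Completing the square in \<open>eq2\<close>: the second numerator is the square
    of the left side of \<open>eq1\<close>, hence of
    \<open>\<omega> (h s) * cos \<theta>\<close>.\<close>
  have "a\<^sup>2 + (a * F (h s) + b * (\<omega> (h s))\<^sup>2)\<^sup>2 / (\<omega> (h s))\<^sup>2 = 1"
    using eq2 omega_pos[OF u] by (simp add: field_simps power2_eq_square)
  then have "a\<^sup>2 + (cos \<theta>)\<^sup>2 = 1"
    using omega_pos[OF u] by (simp add: eq1 power_mult_distrib)
  then show "a\<^sup>2 = (sin \<theta>)\<^sup>2"
    using sin_cos_squared_add[of \<theta>] by linarith
qed


subsection \<open>Loxodromes\<close>

lemma loxodrome_unit_speed:
  assumes "loxodrome N g X M f J c \<theta>" "s \<in> J"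
  shows "vec_norm g (f (c s)) (velocity N (f \<circ> c) s) = 1"
    and "g (f (c s)) (velocity N (f \<circ> c) s) (X (f (c s))) = vec_norm g (f (c s)) (X (f (c s))) * cos \<theta>"
  using assms unfolding loxodrome_def by blast+

lemma loxodrome_diff_at:
  assumes "loxodrome N g X M f J c \<theta>" "s \<in> J"
  shows "diff_at euclidean_mfd M c s"
  by (rule smooth_map_on_diff_at[OF _ assms(2)]) (use assms(1) in \<open>simp add: loxodrome_def\<close>)

lemma loxodrome_angle_pos:
  assumes lox: "loxodrome N g X M f J c \<theta>" and u: "u \<in> I"
    and not_orbit: "\<not> (\<exists>p\<in>points N. (f \<circ> c) ` J \<subseteq> flow_orbit N \<phi> p)"
  shows "0 < sin \<theta>"
proof -
  have J: "open J" "connected J" and \<theta>: "0 \<le> \<theta>" "\<theta> < pi"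
    using lox unfolding loxodrome_def by (auto simp: is_interval_connected)
  have "\<theta> \<noteq> 0"
  proof
    assume \<theta>0: "\<theta> = 0"
    \<comment> \<open>An empty \<open>J\<close> would have its empty image inside the orbit of
      \<open>\<gamma> u\<close>, contrary to \<open>not_orbit\<close>.\<close>
    obtain t where t: "t \<in> J"
      using not_orbit regular_points[OF lift_regular[OF u]] by blast
    have x: "c s \<in> points M" if "s \<in> J" for s
      by (rule diff_at_points(2)[OF loxodrome_diff_at[OF lox that]])
    have d: "diff_at euclidean_mfd N (f \<circ> c) s" if "s \<in> J" for s
      by (rule diff_at_compose[OF charted_euclidean surface_charted loxodrome_diff_at[OF lox that]
            immersion_diff_at[OF x[OF that]]])
    have vel: "velocity N (f \<circ> c) s =
        (\<lambda>\<kappa>. (1 / vec_norm g (f (c s)) (X (f (c s)))) *\<^sub>R X ((f \<circ> c) s) \<kappa>)" if s: "s \<in> J" for s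
    proof -
      have p: "f (c s) \<in> points N"
        by (rule regular_points[OF immersion_regular[OF x[OF s]]])
      have v: "velocity N (f \<circ> c) s \<in> tangent_space N (f (c s))"
        using velocity_in_tangent_space[OF smooth d[OF s]] by simp
      have "g (f (c s)) (velocity N (f \<circ> c) s) (velocity N (f \<circ> c) s) = 1"
        using loxodrome_unit_speed(1)[OF lox s] by (simp add: vec_norm_def)
      then have eq: "X (f (c s)) = (\<lambda>\<kappa>. vec_norm g (f (c s)) (X (f (c s))) *\<^sub>R velocity N (f \<circ> c) s \<kappa>)"
        using loxodrome_unit_speed(2)[OF lox s] \<theta>0 by (intro unit_parallel_field[OF p v]) simp_all
      have "vec_norm g (f (c s)) (X (f (c s))) \<noteq> 0"
        using metric_pos[OF p field_tangent[OF p] field_nonzero_surface[OF x[OF s] u]]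
        by (simp add: vec_norm_def)
      then show ?thesis
        using fun_cong[OF eq] by (intro ext) simp
    qed
    have "(f \<circ> c) ` J \<subseteq> flow_orbit N \<phi> ((f \<circ> c) t)"
    proof (rule image_subsetI)
      fix s assume "s \<in> J"
      then show "(f \<circ> c) s \<in> flow_orbit N \<phi> ((f \<circ> c) t)"
        using along_field_in_orbit[OF J d _ vel _ t] immersion_regular x by simp
    qed
    moreover have "(f \<circ> c) t \<in> points N"
      using regular_points[OF immersion_regular[OF x[OF t]]] by simp
    ultimately show False
      using not_orbit by blast
  qed
  then show ?thesis
    using \<theta> by (intro sin_gt_zero) auto
qed

text \<open>The ball lies in the preimage of the patch; being an interval, it carries a single sign
  \<open>\<sigma>\<close>. The height \<open>v\<close> is kept as a witness so that its membership
  in the strip survives next to the integral formula.\<close>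

lemma loxodrome_local_parametrization:
  assumes lox: "loxodrome N g X M f J c \<theta>"
    and not_orbit: "\<not> (\<exists>p\<in>points N. (f \<circ> c) ` J \<subseteq> flow_orbit N \<phi> p)"
    and s0: "s\<^sub>0 \<in> J" and u0: "u\<^sub>0 \<in> I" and v0: "v\<^sub>0 \<in> {-\<epsilon><..<\<epsilon>}" and c0: "c s\<^sub>0 = \<Psi> (u\<^sub>0, v\<^sub>0)"
  obtains \<sigma> r where "\<sigma> \<in> {1, -1}" "0 < r" "ball s\<^sub>0 r \<subseteq> J" "0 < sin \<theta>"
    "\<And>s. s \<in> ball s\<^sub>0 r \<Longrightarrow> u\<^sub>0 + \<sigma> * sin \<theta> * (s - s\<^sub>0) \<in> I \<and>
       (\<exists>v\<in>{-\<epsilon><..<\<epsilon>}. c s = \<Psi> (u\<^sub>0 + \<sigma> * sin \<theta> * (s - s\<^sub>0), v) \<and>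
         v = v\<^sub>0 + (LBINT t=ereal u\<^sub>0..ereal (u\<^sub>0 + \<sigma> * sin \<theta> * (s - s\<^sub>0)).
           - F t / (\<omega> t)\<^sup>2 + \<sigma> * (cot \<theta> / \<omega> t)))"
proof -
  have sin: "0 < sin \<theta>"
    by (rule loxodrome_angle_pos[OF lox u0 not_orbit])
  have hom: "homeomorphic_map (top_of_set W) (subtopology (mtop M) (\<Psi> ` W)) \<Psi>"
    and op: "openin (mtop M) (\<Psi> ` W)"
    using regular_param unfolding regular_parametrization_def by blast+
  have inj: "inj_on \<Psi> W"
    using homeomorphic_imp_injective_map[OF hom] by simp
  define S' where "S' = {s \<in> J. c s \<in> \<Psi> ` W}"
  have "smooth_map_on J euclidean_mfd M c"
    using lox unfolding loxodrome_def by blast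
  from smooth_map_on_vimage[OF this op] have "open S'"
    by (simp add: S'_def)
  moreover have "s\<^sub>0 \<in> S'"
    using s0 u0 v0 c0 by (auto simp: S'_def)
  ultimately obtain r where r: "0 < r" "ball s\<^sub>0 r \<subseteq> S'"
    using openE by blast
  define S where "S = ball s\<^sub>0 r"
  have S: "open S" "is_interval S" "s\<^sub>0 \<in> S"
    using r(1) by (simp_all add: S_def is_interval_convex_1)
  have SJ: "s \<in> J" and cW: "c s \<in> \<Psi> ` W" if "s \<in> S" for s
    using r(2) that by (auto simp: S_def S'_def)
  \<comment> \<open>\<open>h\<close> and \<open>k\<close> are the patch coordinates of the curve in
    \<open>M\<close>; injectivity of \<open>\<Psi>\<close> on \<open>W\<close> yields their values
    at \<open>s\<^sub>0\<close>.\<close>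
  define hk where "hk = inv_into W \<Psi> \<circ> c"
  define h where "h s = fst (hk s)" for s
  define k where "k s = snd (hk s)" for s
  have hkW: "(h s, k s) \<in> W" and c: "c s = \<Psi> (h s, k s)" if "s \<in> S" for s
    using inv_into_into[OF cW[OF that]] f_inv_into_f[OF cW[OF that]]
    by (simp_all add: h_def k_def hk_def)
  have hk0: "h s\<^sub>0 = u\<^sub>0" "k s\<^sub>0 = v\<^sub>0"
    using inj_onD[OF inj, of "(h s\<^sub>0, k s\<^sub>0)" "(u\<^sub>0, v\<^sub>0)"] c[OF S(3)] c0 hkW[OF S(3)] u0 v0 by auto
  have hkd: "hk differentiable (at s)" if "s \<in> S" for s
    unfolding hk_def
    by (rule regular_parametrization_inverse_differentiable[OF surface_smooth open_W regular_param
          loxodrome_diff_at[OF lox SJ[OF that]] cW[OF that]])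
  have "h differentiable (at s)" "k differentiable (at s)" if "s \<in> S" for s
    using hkd[OF that] has_derivative_fst[of hk] has_derivative_snd[of hk]
    unfolding differentiable_def h_def[abs_def] k_def[abs_def] by blast+
  then have h: "(h has_real_derivative deriv h s) (at s)" and k: "(k has_real_derivative deriv k s) (at s)"
    if "s \<in> S" for s
    using that by (simp_all add: DERIV_deriv_iff_real_differentiable)
  have eq: "(deriv h s)\<^sup>2 = (sin \<theta>)\<^sup>2"
    "deriv k s = (\<omega> (h s) * cos \<theta> - deriv h s * F (h s)) / (\<omega> (h s))\<^sup>2" if s: "s \<in> S" for s
    using loxodrome_equations[OF S(1) s c hkW[OF s] h[OF s] k[OF s] loxodrome_unit_speed[OF lox SJ[OF s]]]
    by blast+
  obtain \<sigma> where \<sigma>: "\<sigma> \<in> {1, -1}" "\<And>s. s \<in> S \<Longrightarrow> deriv h s = \<sigma> * sin \<theta>"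
    using derivative_constant_modulus[OF S(1,2) h eq(1) sin] by blast
  have hs: "h s = u\<^sub>0 + \<sigma> * sin \<theta> * (s - s\<^sub>0)" if "s \<in> S" for s
    using affine_if_derivative_constant[OF S(1,2) _ S(3) that, of h "\<sigma> * sin \<theta>"] h \<sigma>(2) hk0 by simp
  define q where "q t = - F t / (\<omega> t)\<^sup>2 + \<sigma> * (cot \<theta> / \<omega> t)" for t
  have integral: "(LBINT t=ereal u\<^sub>0..ereal (u\<^sub>0 + \<sigma> * sin \<theta> * (s - s\<^sub>0)). q t) = k s - k s\<^sub>0"
    if s: "s \<in> S" for s
  proof (rule integral_along_affine[OF S(2) _ _ _ S(3) s])
    fix r assume r: "r \<in> S"
    have I: "h r \<in> I"
      using hkW[OF r] by simp
    show "isCont q (u\<^sub>0 + \<sigma> * sin \<theta> * (r - s\<^sub>0))"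
      unfolding hs[OF r, symmetric] q_def
      using continuous_F[OF I] continuous_omega[OF I] omega_pos[OF I] by (intro continuous_intros) auto
    \<comment> \<open>As \<open>\<sigma>\<close> squares to 1, \<open>cos \<theta>\<close> equals
      \<open>\<sigma> * sin \<theta>\<close> times \<open>\<sigma> * cot \<theta>\<close>. So the
      sign of \<open>h'\<close> reappears in front of the cotangent.\<close>
    have "deriv k r = \<sigma> * sin \<theta> * q (h r)"
      unfolding eq(2)[OF r] \<sigma>(2)[OF r] using \<sigma>(1) sin omega_pos[OF I]
      by (auto simp: q_def cot_def field_simps power2_eq_square)
    then show "(k has_real_derivative \<sigma> * sin \<theta> * q (u\<^sub>0 + \<sigma> * sin \<theta> * (r - s\<^sub>0))) (at r)"
      using k[OF r] by (simp add: hs[OF r])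
  qed (use \<sigma>(1) sin in auto)
  show thesis
  proof (rule that[OF \<sigma>(1) r(1) _ sin])
    show "ball s\<^sub>0 r \<subseteq> J"
      using SJ unfolding S_def by blast
    fix s assume "s \<in> ball s\<^sub>0 r"
    then have s: "s \<in> S"
      by (simp add: S_def)
    show "u\<^sub>0 + \<sigma> * sin \<theta> * (s - s\<^sub>0) \<in> I \<and>
       (\<exists>v\<in>{-\<epsilon><..<\<epsilon>}. c s = \<Psi> (u\<^sub>0 + \<sigma> * sin \<theta> * (s - s\<^sub>0), v) \<and>
         v = v\<^sub>0 + (LBINT t=ereal u\<^sub>0..ereal (u\<^sub>0 + \<sigma> * sin \<theta> * (s - s\<^sub>0)).
           - F t / (\<omega> t)\<^sup>2 + \<sigma> * (cot \<theta> / \<omega> t)))"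
      using hkW[OF s] c[OF s] integral[OF s] hk0(2)
      unfolding hs[OF s] q_def by (intro conjI bexI[of _ "k s"]) auto
  qed
qed

end

text \<open>The curve \<open>\<beta> \<sigma>\<close> starts at \<open>\<gamma> u\<^sub>0\<close>,
  whereas the loxodrome starts at height \<open>v\<^sub>0\<close>. The group law absorbs this
  initial value into the isometry \<open>\<phi> v\<^sub>0\<close>. The map \<open>h\<close> changes
  from arc length to the parameter \<open>u\<close>, and \<open>\<sigma>\<close> records whether
  \<open>u\<close> increases or decreases along the loxodrome.\<close>

theorem theorem2p3:
  fixes N :: "('a, real^3) mfd" and g :: "('a, real^3) metric_field"
    and X :: "'a \<Rightarrow> ('a, real^3) tvec" and \<phi> :: "real \<Rightarrow> 'a \<Rightarrow> 'a"
    and B :: "('a set, real^2) mfd" and gB :: "('a set, real^2) metric_field"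
    and M :: "('m, real^2) mfd" and f :: "'m \<Rightarrow> 'a" and \<rho> :: "('a \<Rightarrow> 'a) \<Rightarrow> 'm \<Rightarrow> 'm"
    and J I :: "real set" and c :: "real \<Rightarrow> 'm" and \<theta>\<^sub>0 \<epsilon> s\<^sub>0 u\<^sub>0 v\<^sub>0 :: real
    and \<gamma>t :: "real \<Rightarrow> 'a set" and \<gamma> :: "real \<Rightarrow> 'a" and \<Psi> :: "real \<times> real \<Rightarrow> 'm"
    and \<psi> :: "real \<Rightarrow> real \<Rightarrow> 'a" and F \<omega> :: "real \<Rightarrow> real" and v :: "real \<Rightarrow> real \<Rightarrow> real"
    and \<beta> :: "real \<Rightarrow> real \<Rightarrow> 'a"
  assumes "riemannian_manifold N g"
    and "killing_field_flow N g X \<phi>"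
    and "riemannian_quotient N g \<phi> B gB"
    and "invariant_surface N \<phi> M f \<rho>"
    and "loxodrome N g X M f J c \<theta>\<^sub>0"
    and not_an_orbit: "\<not> (\<exists>p\<in>points N. (f \<circ> c) ` J \<subseteq> flow_orbit N \<phi> p)"
    and "invariant_parametrization N \<phi> B gB M f I \<epsilon> \<gamma>t \<gamma> \<Psi>"
    and "s\<^sub>0 \<in> J" and "u\<^sub>0 \<in> I" and "v\<^sub>0 \<in> {-\<epsilon><..<\<epsilon>}" and "c s\<^sub>0 = \<Psi> (u\<^sub>0, v\<^sub>0)"
  defines "\<psi> \<equiv> flow_param \<phi> \<gamma>"
    and "F \<equiv> \<lambda>u. coeff_F N g \<psi> u 0"
    and "\<omega> \<equiv> \<lambda>u. vec_norm g (\<gamma> u) (X (\<gamma> u))"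
    and "v \<equiv> \<lambda>\<sigma> u. LBINT t=ereal u\<^sub>0..ereal u. - F t / (\<omega> t)\<^sup>2 + \<sigma> * (cot \<theta>\<^sub>0 / \<omega> t)"
    and "\<beta> \<equiv> \<lambda>\<sigma> u. \<psi> u (v \<sigma> u)"
  shows "\<exists>\<sigma>\<in>{1, -1}. \<exists>J' I' h.
    s\<^sub>0 \<in> J' \<and> J' \<subseteq> J \<and> u\<^sub>0 \<in> I' \<and> I' \<subseteq> I \<and>
    reparametrization J' I' h \<and> h s\<^sub>0 = u\<^sub>0 \<and>
    (\<forall>u\<in>I'. v\<^sub>0 + v \<sigma> u \<in> {-\<epsilon><..<\<epsilon>}) \<and>
    (\<forall>s\<in>J'. f (c s) = \<phi> v\<^sub>0 (\<beta> \<sigma> (h s)))"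
proof -
  interpret P: invariant_patch N g X \<phi> B gB M f \<rho> I \<epsilon> \<gamma>t \<gamma> \<Psi>
    by unfold_locales (use assms(1-7) in simp_all)
  obtain \<sigma> r where \<sigma>: "\<sigma> \<in> {1, -1}" and r: "0 < r" "ball s\<^sub>0 r \<subseteq> J" and sin: "0 < sin \<theta>\<^sub>0"
    and loc: "\<And>s. s \<in> ball s\<^sub>0 r \<Longrightarrow> u\<^sub>0 + \<sigma> * sin \<theta>\<^sub>0 * (s - s\<^sub>0) \<in> I \<and>
       (\<exists>w\<in>{-\<epsilon><..<\<epsilon>}. c s = \<Psi> (u\<^sub>0 + \<sigma> * sin \<theta>\<^sub>0 * (s - s\<^sub>0), w) \<and>
         w = v\<^sub>0 + (LBINT t=ereal u\<^sub>0..ereal (u\<^sub>0 + \<sigma> * sin \<theta>\<^sub>0 * (s - s\<^sub>0)).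
           - P.F t / (P.\<omega> t)\<^sup>2 + \<sigma> * (cot \<theta>\<^sub>0 / P.\<omega> t)))"
    using P.loxodrome_local_parametrization[OF assms(5,6,8-11)] by blast
  define h where "h s = u\<^sub>0 + \<sigma> * sin \<theta>\<^sub>0 * (s - s\<^sub>0)" for s
  have h0: "h s\<^sub>0 = u\<^sub>0"
    by (simp add: h_def)
  have hI: "h s \<in> I" if "s \<in> ball s\<^sub>0 r" for s
    using loc[OF that] by (simp add: h_def)
  have I: "is_interval I"
    using assms(7) unfolding invariant_parametrization_def by blast
  \<comment> \<open>The coefficients of the statement and of the locale agree only on
    \<open>I\<close>; as \<open>I\<close> is an interval, it contains the whole range of
    integration.\<close>
  have v: "v \<sigma> u = (LBINT t=ereal u\<^sub>0..ereal u. - P.F t / (P.\<omega> t)\<^sup>2 + \<sigma> * (cot \<theta>\<^sub>0 / P.\<omega> t))"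
    if u: "u \<in> I" for u
    unfolding v_def
  proof (rule interval_integral_cong)
    fix t assume "t \<in> einterval (min (ereal u\<^sub>0) (ereal u)) (max (ereal u\<^sub>0) (ereal u))"
    then have "min u\<^sub>0 u \<le> t" "t \<le> max u\<^sub>0 u"
      by (auto simp: einterval_def min_def max_def split: if_splits)
    then have "t \<in> I"
      using mem_is_interval_1_I[OF I assms(9) u, of t] mem_is_interval_1_I[OF I u assms(9), of t]
      by (auto simp: min_def max_def split: if_splits)
    then show "- F t / (\<omega> t)\<^sup>2 + \<sigma> * (cot \<theta>\<^sub>0 / \<omega> t) = - P.F t / (P.\<omega> t)\<^sup>2 + \<sigma> * (cot \<theta>\<^sub>0 / P.\<omega> t)"
      by (simp add: F_def \<omega>_def \<psi>_def P.coeff_F_eq P.\<omega>_def)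
  qed
  have pt: "v\<^sub>0 + v \<sigma> (h s) \<in> {-\<epsilon><..<\<epsilon>}" "c s = \<Psi> (h s, v\<^sub>0 + v \<sigma> (h s))" if "s \<in> ball s\<^sub>0 r" for s
    using loc[OF that] v[OF hI[OF that]] by (auto simp: h_def)
  have eq: "f (c s) = \<phi> v\<^sub>0 (\<beta> \<sigma> (h s))" if "s \<in> ball s\<^sub>0 r" for s
    unfolding \<beta>_def \<psi>_def flow_param_def
    using P.param_eq[OF hI[OF that] pt(1)[OF that]] pt(2)[OF that]
      P.flow_add[OF P.lift_points[OF hI[OF that]]] by simp
  show ?thesis
  proof (intro bexI[OF _ \<sigma>] exI conjI ballI)
    show "s\<^sub>0 \<in> ball s\<^sub>0 r" "ball s\<^sub>0 r \<subseteq> J" "h s\<^sub>0 = u\<^sub>0" "u\<^sub>0 \<in> h ` ball s\<^sub>0 r"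
      using r h0 by (auto intro: rev_image_eqI[of s\<^sub>0])
    show "h ` ball s\<^sub>0 r \<subseteq> I"
      using hI by blast
    show "reparametrization (ball s\<^sub>0 r) (h ` ball s\<^sub>0 r) h"
      using affine_reparametrization[OF r(1), of "\<sigma> * sin \<theta>\<^sub>0" s\<^sub>0 u\<^sub>0] \<sigma> sin
      unfolding h_def[abs_def] by auto
    show "v\<^sub>0 + v \<sigma> u \<in> {-\<epsilon><..<\<epsilon>}" if "u \<in> h ` ball s\<^sub>0 r" for u
      using pt(1) that by blast
  qed (rule eq)
qed

end
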